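(* For every integer $c\geq 2$ let $M_c=\langle x_0,x_1,\ldots,x_c\mid [x_0,x_i]=x_{i+1}\text{ for all }1\leq i\leq c-1\rangle$. Then for every $c\geq2$ and every prime $p$, $$\zeta_{M_c(\mathbb{F}_p)}^{\triangleleft}(s)=1+(1+p)t+\sum_{k=2}^{c+1}t^k=\zeta_{\mathbb{F}_p^2}(s)+\sum_{k=3}^{c+1}t^k.$$
   Context: A presentation of a Lie ring lists a $\mathbb{Z}$-module basis together with brackets of basis elements; all brackets not listed are zero, up to antisymmetry. For a Lie ring $L\cong\mathbb{Z}^n$ (additively) and a prime $p$, $L(\mathbb{F}_p)=L\otimes_{\mathbb{Z}}\mathbb{F}_p$, and $\zeta_{L(\mathbb{F}_p)}^{\triangleleft}(s)=\sum_{i=0}^{n}a_{p^i}^{\triangleleft}(L(\mathbb{F}_p))\,t^{i}$, where $t=p^{-s}$ and $a_{p^i}^{\triangleleft}(L(\mathbb{F}_p))$ is the number of Lie ideals of $L(\mathbb{F}_p)$ of codimension $i$. Also $\zeta_{\mathbb{F}_p^m}(s)=\sum_{i=0}^m\binom{m}{i}_p t^i$, where $\binom{m}{i}_p$ is the Gaussian binomial coefficient (number of $i$-dimensional subspaces of $\mathbb{F}_p^m$); so $\zeta_{\mathbb{F}_p^2}(s)=1+(1+p)t+t^2$. *)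

theory Defs
  imports
    "HOL-Analysis.Complex_Transcendental"
    "HOL-Number_Theory.Residues"
    "HOL-Algebra.IntRing"
    "HOL-Algebra.Free_Abelian_Groups"
    "Jordan_Normal_Form.Missing_VectorSpace"
begin

text \<open>The multiplicative fields \<open>mult\<close> and \<open>one\<close> that the record \<open>module\<close> inherits from
  \<open>ring\<close> carry no meaning here.\<close>

record ('a, 'b) lie_struct = "('a, 'b) module" +
  bracket :: "'b \<Rightarrow> 'b \<Rightarrow> 'b"

text \<open>A Lie ring is a Lie algebra over \<open>\<Z>\<close>.\<close>

locale lie_algebra = module R L
  for R (structure) and L :: "('a, 'b) lie_struct" (structure) +
  assumes bracket_closed:
      "\<lbrakk>x \<in> carrier L; y \<in> carrier L\<rbrakk> \<Longrightarrow> bracket L x y \<in> carrier L"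
    and bracket_add_left:
      "\<lbrakk>x \<in> carrier L; y \<in> carrier L; z \<in> carrier L\<rbrakk>
        \<Longrightarrow> bracket L (x \<oplus>\<^bsub>L\<^esub> y) z = bracket L x z \<oplus>\<^bsub>L\<^esub> bracket L y z"
    and bracket_add_right:
      "\<lbrakk>x \<in> carrier L; y \<in> carrier L; z \<in> carrier L\<rbrakk>
        \<Longrightarrow> bracket L x (y \<oplus>\<^bsub>L\<^esub> z) = bracket L x y \<oplus>\<^bsub>L\<^esub> bracket L x z"
    and bracket_smult_left:
      "\<lbrakk>a \<in> carrier R; x \<in> carrier L; y \<in> carrier L\<rbrakk>
        \<Longrightarrow> bracket L (a \<odot>\<^bsub>L\<^esub> x) y = a \<odot>\<^bsub>L\<^esub> bracket L x y"
    and bracket_smult_right: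
      "\<lbrakk>a \<in> carrier R; x \<in> carrier L; y \<in> carrier L\<rbrakk>
        \<Longrightarrow> bracket L x (a \<odot>\<^bsub>L\<^esub> y) = a \<odot>\<^bsub>L\<^esub> bracket L x y"
    and bracket_self: "x \<in> carrier L \<Longrightarrow> bracket L x x = \<zero>\<^bsub>L\<^esub>"
    and jacobi:
      "\<lbrakk>x \<in> carrier L; y \<in> carrier L; z \<in> carrier L\<rbrakk>
        \<Longrightarrow> bracket L x (bracket L y z) \<oplus>\<^bsub>L\<^esub> bracket L y (bracket L z x)
              \<oplus>\<^bsub>L\<^esub> bracket L z (bracket L x y) = \<zero>\<^bsub>L\<^esub>"


subsection \<open>Presentations\<close>

text \<open>
  The free \<open>\<Z>\<close>-module with basis \<open>x\<^sub>0, \<dots>, x\<^sub>c\<close> and the brackets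
  \<open>[x\<^sub>i, x\<^sub>j] = (\<Sum>k. \<gamma> i j k x\<^sub>k)\<close>.  Each bracket is listed in at most one of the two orders, that
  is, for each pair \<open>i, j\<close> at most one of \<open>\<gamma> i j\<close>, \<open>\<gamma> j i\<close> is nonzero; the bracket in the other
  order is then its negative, and everything not listed is zero.
\<close>

definition presented_lie_ring ::
  "nat \<Rightarrow> (nat \<Rightarrow> nat \<Rightarrow> nat \<Rightarrow> int) \<Rightarrow> (int, nat \<Rightarrow> int) lie_struct" where
  "presented_lie_ring c \<gamma> = module.extend (ring.func_space \<Z> {..c})
     (lie_struct.fields (\<lambda>v w. \<lambda>k\<in>{..c}. \<Sum>i\<le>c. \<Sum>j\<le>c. (v i * w j - v j * w i) * \<gamma> i j k))"

definition Mc :: "nat \<Rightarrow> (int, nat \<Rightarrow> int) lie_struct" where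
  "Mc c = presented_lie_ring c
     (\<lambda>i j k. if i = 0 \<and> 1 \<le> j \<and> j \<le> c - 1 \<and> k = j + 1 then 1 else 0)"

lemma carrier_Mc: "carrier (Mc c) = {..c} \<rightarrow>\<^sub>E UNIV"
  and zero_Mc: "\<zero>\<^bsub>Mc c\<^esub> = (\<lambda>k\<in>{..c}. 0)"
  and add_Mc: "v \<oplus>\<^bsub>Mc c\<^esub> w = (\<lambda>k\<in>{..c}. v k + w k)"
  and smult_Mc: "a \<odot>\<^bsub>Mc c\<^esub> v = (\<lambda>k\<in>{..c}. a * v k)"
  by (simp_all add: Mc_def presented_lie_ring_def ring.func_space_def[OF ring.intro, OF
      int.is_abelian_group int.monoid_axioms int.ring_axioms[THEN ring.axioms(3)]]
      module.defs lie_struct.defs)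

lemma bracket_Mc:
  "bracket (Mc c) v w =
     (\<lambda>k\<in>{..c}. if 2 \<le> k then v 0 * w (k - 1) - w 0 * v (k - 1) else 0)"
proof (rule ext)
  fix k
  let ?\<gamma> = "\<lambda>(i::nat) (j::nat) (k::nat).
      if i = 0 \<and> 1 \<le> j \<and> j \<le> c - 1 \<and> k = j + 1 then 1 else (0::int)"
  have "(\<Sum>i\<le>c. \<Sum>j\<le>c. (v i * w j - v j * w i) * ?\<gamma> i j k)
      = (if 2 \<le> k then v 0 * w (k - 1) - w 0 * v (k - 1) else 0)" if k: "k \<le> c"
  proof -
    have "(\<Sum>i\<le>c. \<Sum>j\<le>c. (v i * w j - v j * w i) * ?\<gamma> i j k)
        = (\<Sum>i\<le>c. if i = 0 then \<Sum>j\<le>c. (v 0 * w j - v j * w 0) * ?\<gamma> 0 j k else 0)"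
      by (intro sum.cong) auto
    also have "\<dots> = (\<Sum>j\<le>c. (v 0 * w j - v j * w 0) * ?\<gamma> 0 j k)"
      by simp
    also have "\<dots> = (\<Sum>j\<le>c. if j = k - 1 then
        (if 2 \<le> k then v 0 * w (k - 1) - w 0 * v (k - 1) else 0) else 0)"
      using k by (intro sum.cong) auto
    also have "\<dots> = (if 2 \<le> k then v 0 * w (k - 1) - w 0 * v (k - 1) else 0)"
      using k by simp
    finally show ?thesis .
  qed
  then show "bracket (Mc c) v w k =
     (\<lambda>k\<in>{..c}. if 2 \<le> k then v 0 * w (k - 1) - w 0 * v (k - 1) else 0) k"
    by (simp add: Mc_def presented_lie_ring_def module.defs lie_struct.defs)
qed

lemma lie_algebra_Mc: "lie_algebra \<Z> (Mc c)"
proof -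
  have "abelian_group (Mc c)"
  proof (rule abelian_groupI)
    show "\<exists>w\<in>carrier (Mc c). w \<oplus>\<^bsub>Mc c\<^esub> v = \<zero>\<^bsub>Mc c\<^esub>" if "v \<in> carrier (Mc c)" for v
      by (rule bexI[of _ "\<lambda>k\<in>{..c}. - v k"]) (auto simp: carrier_Mc zero_Mc add_Mc)
  qed (auto simp: carrier_Mc zero_Mc add_Mc fun_eq_iff PiE_def extensional_def)
  then have "module \<Z> (Mc c)"
    by (intro moduleI)
       (auto simp: int.is_cring carrier_Mc zero_Mc add_Mc smult_Mc fun_eq_iff PiE_def
        extensional_def algebra_simps)
  then show ?thesis
    by (intro lie_algebra.intro lie_algebra_axioms.intro)
       (simp_all add: carrier_Mc zero_Mc add_Mc smult_Mc bracket_Mc restrict_def PiE_def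
         extensional_def fun_eq_iff algebra_simps, arith+)
qed

lemma basis_bracket_Mc:
  defines "x \<equiv> \<lambda>c i. \<lambda>k\<in>{..c}. if k = i then 1 else (0::int)"
  assumes "1 \<le> i" "i \<le> c - 1"
  shows "bracket (Mc c) (x c 0) (x c i) = x c (i + 1)"
  using assms by (auto simp: bracket_Mc fun_eq_iff)


subsection \<open>Extension of scalars\<close>

text \<open>
  \<open>L \<otimes>\<^sub>\<Z> S\<close> is the free abelian group on the symbols \<open>(a, r)\<close> modulo biadditivity (over \<open>\<Z>\<close> the
  relation \<open>n a \<otimes> r = a \<otimes> n r\<close> follows).  The scalars act by \<open>r (a \<otimes> s) = a \<otimes> r s\<close> and the
  bracket is \<open>[a \<otimes> r, b \<otimes> s] = [a, b] \<otimes> r s\<close>, both extended additively to formal sums and then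
  to cosets; the unions below are unions of equal cosets.
\<close>

definition tensor_relations ::
  "(int, 'a, 'm) module_scheme \<Rightarrow> ('s, 'n) ring_scheme \<Rightarrow> ('a \<times> 's \<Rightarrow>\<^sub>0 int) set" where
  "tensor_relations L S =
     {frag_of (a \<oplus>\<^bsub>L\<^esub> b, r) - frag_of (a, r) - frag_of (b, r) |
        a b r. a \<in> carrier L \<and> b \<in> carrier L \<and> r \<in> carrier S} \<union>
     {frag_of (a, r \<oplus>\<^bsub>S\<^esub> s) - frag_of (a, r) - frag_of (a, s) |
        a r s. a \<in> carrier L \<and> r \<in> carrier S \<and> s \<in> carrier S}"

definition tensor_kernel ::
  "(int, 'a, 'm) module_scheme \<Rightarrow> ('s, 'n) ring_scheme \<Rightarrow> ('a \<times> 's \<Rightarrow>\<^sub>0 int) set" where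
  "tensor_kernel L S =
     generate (free_Abelian_group (carrier L \<times> carrier S)) (tensor_relations L S)"

definition tensor_class ::
  "(int, 'a, 'm) module_scheme \<Rightarrow> ('s, 'n) ring_scheme \<Rightarrow>
     ('a \<times> 's \<Rightarrow>\<^sub>0 int) \<Rightarrow> ('a \<times> 's \<Rightarrow>\<^sub>0 int) set" where
  "tensor_class L S f =
     tensor_kernel L S #>\<^bsub>free_Abelian_group (carrier L \<times> carrier S)\<^esub> f"

definition tensor_group ::
  "(int, 'a, 'm) module_scheme \<Rightarrow> ('s, 'n) ring_scheme \<Rightarrow> ('a \<times> 's \<Rightarrow>\<^sub>0 int) set monoid" where
  "tensor_group L S =
     free_Abelian_group (carrier L \<times> carrier S) Mod tensor_kernel L S"

definition base_change ::
  "(int, 'a) lie_struct \<Rightarrow> ('s, 'n) ring_scheme \<Rightarrow>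
     ('s, ('a \<times> 's \<Rightarrow>\<^sub>0 int) set) lie_struct" where
  "base_change L S =
     \<lparr>carrier = carrier (tensor_group L S),
      monoid.mult = (\<lambda>_ _. \<one>\<^bsub>tensor_group L S\<^esub>),
      one = \<one>\<^bsub>tensor_group L S\<^esub>,
      ring.zero = \<one>\<^bsub>tensor_group L S\<^esub>,
      add = monoid.mult (tensor_group L S),
      module.smult = (\<lambda>r X. \<Union>f\<in>X.
        tensor_class L S (frag_extend (\<lambda>(a, s). frag_of (a, r \<otimes>\<^bsub>S\<^esub> s)) f)),
      bracket = (\<lambda>X Y. \<Union>f\<in>X. \<Union>g\<in>Y.
        tensor_class L S (frag_extend (\<lambda>(a, r).
          frag_extend (\<lambda>(b, s). frag_of (bracket L a b, r \<otimes>\<^bsub>S\<^esub> s)) g) f))\<rparr>"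

abbreviation Fp :: "nat \<Rightarrow> int ring" where
  "Fp p \<equiv> residue_ring (int p)"


subsection \<open>Zeta functions\<close>

definition lie_ideal :: "('a, 'c) ring_scheme \<Rightarrow> ('a, 'b) lie_struct \<Rightarrow> 'b set \<Rightarrow> bool" where
  "lie_ideal K A I \<longleftrightarrow>
     VectorSpace.subspace K I A \<and> (\<forall>x\<in>carrier A. \<forall>y\<in>I. bracket A x y \<in> I)"

abbreviation vs_dim ::
  "('a, 'c) ring_scheme \<Rightarrow> ('a, 'b, 'd) module_scheme \<Rightarrow> nat" where
  "vs_dim K V \<equiv> vectorspace.dim K V"

definition num_ideals :: "('a, 'c) ring_scheme \<Rightarrow> ('a, 'b) lie_struct \<Rightarrow> nat \<Rightarrow> nat" where
  "num_ideals K A i =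
     card {I. lie_ideal K A I \<and> vs_dim K (A\<lparr>carrier := I\<rparr>) + i = vs_dim K A}"

text \<open>For \<open>A = L(\<F>\<^sub>p)\<close> the dimension of \<open>A\<close> is the rank of \<open>L\<close>.\<close>

definition ideal_zeta :: "nat \<Rightarrow> (int, 'b) lie_struct \<Rightarrow> complex \<Rightarrow> complex" where
  "ideal_zeta p A s =
     (\<Sum>i = 0..vs_dim (Fp p) A. of_nat (num_ideals (Fp p) A i) * (of_nat p powr (- s)) ^ i)"

definition gaussian_binomial :: "nat \<Rightarrow> nat \<Rightarrow> nat \<Rightarrow> nat" where
  "gaussian_binomial p m i =
     (let V = ring.func_space (Fp p) {..<m} in
      card {W. VectorSpace.subspace (Fp p) W V \<and> vs_dim (Fp p) (V\<lparr>carrier := W\<rparr>) = i})"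

definition subspace_zeta :: "nat \<Rightarrow> nat \<Rightarrow> complex \<Rightarrow> complex" where
  "subspace_zeta p m s =
     (\<Sum>i = 0..m. of_nat (gaussian_binomial p m i) * (of_nat p powr (- s)) ^ i)"

end

theory Submission
  imports Defs
begin

text \<open>
  Sending a formal sum of symbols \<open>(a, r)\<close> to its coordinates \<open>\<Sum> a\<^sub>k r mod p\<close> identifies
  \<open>M\<^sub>c \<otimes> \<F>\<^sub>p\<close> with \<open>\<F>\<^sub>p\<^bsup>c+1\<^esup>\<close>.  There, bracketing with \<open>x\<^sub>0\<close> shifts coordinates to the right,
  so an ideal inside \<open>v\<^sub>0 = 0\<close> whose first nonzero coordinate has index \<open>k\<close> is the whole flag member
  \<open>\<langle>x\<^sub>k, \<dots>, x\<^sub>c\<rangle>\<close>.  An ideal with an element having \<open>v\<^sub>0 \<noteq> 0\<close> contains \<open>[x\<^sub>1, v]\<close>, hence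
  \<open>\<langle>x\<^sub>2, \<dots>, x\<^sub>c\<rangle>\<close>, and is therefore everything or one of the \<open>p\<close> hyperplanes \<open>v\<^sub>1 = a v\<^sub>0\<close>.  Dimensions
  are read off from cardinalities: a space with \<open>q\<^sup>d\<close> elements has dimension \<open>d\<close>.  For \<open>c = 1\<close> the
  bracket vanishes and the same classification lists the subspaces of \<open>\<F>\<^sub>p\<^sup>2\<close>.
\<close>

subsection \<open>Finite vector spaces and transport of structure\<close>

text \<open>A finite carrier spans itself, so a finite basis \<open>B\<close> exists, and
  coordinates with respect to \<open>B\<close> biject the space with the functions from
  \<open>B\<close> to the field. Questions about \<open>vs_dim\<close> thereby become questions
  about cardinalities.\<close>

lemma (in vectorspace) card_carrier_eq_power_dim:
  assumes "finite (carrier V)"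
  shows "card (carrier V) = card (carrier K) ^ dim"
proof -
  have "fin_dim"
    unfolding fin_dim_def
    by (intro exI[of _ "carrier V"] conjI subset_antisym)
       (use assms in_own_span[of "carrier V"] span_is_subset2[of "carrier V"] in auto)
  then obtain B where B: "finite B" "basis B"
    using finite_basis_exists by blast
  have BV: "B \<subseteq> carrier V"
    using B by (simp add: basis_def)
  have unique: "\<exists>!a. a \<in> B \<rightarrow>\<^sub>E carrier K \<and> lincomb a B = v" if "v \<in> carrier V" for v
    using basis_criterion[OF B(1) BV] B(2) that by blast
  have "lincomb a B \<in> carrier V" if "a \<in> B \<rightarrow>\<^sub>E carrier K" for a
    using that BV by (intro lincomb_closed) auto
  then have "bij_betw (\<lambda>a. lincomb a B) (B \<rightarrow>\<^sub>E carrier K) (carrier V)"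
    using unique by (intro bij_betwI') metis+
  then have "card (carrier V) = card (B \<rightarrow>\<^sub>E carrier K)"
    by (simp add: bij_betw_same_card)
  then show ?thesis
    using B by (simp add: card_funcsetE dim_basis)
qed

lemma (in vectorspace) card_subspace_eq_power_dim:
  assumes "finite (carrier V)" "VectorSpace.subspace K W V"
  shows "card W = card (carrier K) ^ vs_dim K (V\<lparr>carrier := W\<rparr>)"
proof -
  have "finite W"
    using assms by (auto simp: VectorSpace.subspace_def submodule_def intro: finite_subset)
  then show ?thesis
    using vectorspace.card_carrier_eq_power_dim[OF subspace_is_vs[OF assms(2)]] by simp
qed

lemma (in field) card_carrier_gt_1:
  assumes "finite (carrier R)"
  shows "1 < card (carrier R)"
proof -
  have "card {\<zero>, \<one>} \<le> card (carrier R)"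
    by (rule card_mono) (use assms in auto)
  then show ?thesis by simp
qed

text \<open>The field has more than one element, so powers of its size determine their exponents.
  The cardinality form passes through bijections and suits sets given by explicit equations.\<close>

lemma num_ideals_eq_card:
  assumes "vectorspace K A" "finite (carrier K)" "finite (carrier A)"
  shows "num_ideals K A i =
    card {I. lie_ideal K A I \<and> card I * card (carrier K) ^ i = card (carrier A)}"
proof -
  interpret vectorspace K A by fact
  have q: "1 < card (carrier K)"
    using card_carrier_gt_1 assms(2) by blast
  have "vs_dim K (A\<lparr>carrier := I\<rparr>) + i = dim \<longleftrightarrow>
      card I * card (carrier K) ^ i = card (carrier A)" if "lie_ideal K A I" for I
  proof -
    have "VectorSpace.subspace K I A"
      using that by (simp add: lie_ideal_def)
    then have "card I * card (carrier K) ^ i = card (carrier A) \<longleftrightarrow>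
        card (carrier K) ^ (vs_dim K (A\<lparr>carrier := I\<rparr>) + i) = card (carrier K) ^ dim"
      using card_carrier_eq_power_dim card_subspace_eq_power_dim assms(3)
      by (simp add: power_add)
    then show ?thesis
      using q by simp
  qed
  then show ?thesis
    unfolding num_ideals_def by (intro arg_cong[where f = card]) auto
qed

text \<open>Every element of \<open>N\<close> is some \<open>h x\<close>, so each axiom pulls back
  to \<open>M\<close>. This is how cosets of formal sums inherit the module axioms from coordinate
  vectors.\<close>

lemma (in module) module_transport:
  assumes bij: "bij_betw h (carrier M) (carrier N)"
    and h_zero: "h \<zero>\<^bsub>M\<^esub> = \<zero>\<^bsub>N\<^esub>"
    and h_add: "\<And>x y. \<lbrakk>x \<in> carrier M; y \<in> carrier M\<rbrakk> \<Longrightarrow> h (x \<oplus>\<^bsub>M\<^esub> y) = h x \<oplus>\<^bsub>N\<^esub> h y"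
    and h_smult: "\<And>a x. \<lbrakk>a \<in> carrier R; x \<in> carrier M\<rbrakk> \<Longrightarrow> h (a \<odot>\<^bsub>M\<^esub> x) = a \<odot>\<^bsub>N\<^esub> h x"
  shows "module R N"
proof -
  have carrier_N: "carrier N = h ` carrier M"
    using bij by (simp add: bij_betw_def)
  show ?thesis
  proof (rule module_criteria; (intro allI impI ballI)?)
    show "\<exists>w\<in>carrier N. v \<oplus>\<^bsub>N\<^esub> w = \<zero>\<^bsub>N\<^esub>" if v: "v \<in> carrier N" for v
    proof -
      obtain x where x: "x \<in> carrier M" "v = h x"
        using v carrier_N by auto
      then have "v \<oplus>\<^bsub>N\<^esub> h (\<ominus>\<^bsub>M\<^esub> x) = h (x \<oplus>\<^bsub>M\<^esub> \<ominus>\<^bsub>M\<^esub> x)"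
        by (simp add: h_add)
      then show ?thesis
        using x by (intro bexI[of _ "h (\<ominus>\<^bsub>M\<^esub> x)"]) (auto simp: M.r_neg h_zero carrier_N)
    qed
  qed (auto simp: carrier_N h_zero[symmetric] h_add[symmetric] h_smult[symmetric]
      M.a_ac smult_assoc1 smult_l_distr smult_r_distr is_cring)
qed

section \<open>Transport of ideals along a linear bijection preserving brackets\<close>

locale lie_transport =
  fixes K :: "('a, 'k) ring_scheme" and A :: "('a, 'b) lie_struct" and B :: "('a, 'c) lie_struct"
    and h :: "'b \<Rightarrow> 'c"
  assumes vs: "vectorspace K A"
    and bij: "bij_betw h (carrier A) (carrier B)"
    and h_zero: "h \<zero>\<^bsub>A\<^esub> = \<zero>\<^bsub>B\<^esub>"
    and h_add: "\<lbrakk>x \<in> carrier A; y \<in> carrier A\<rbrakk> \<Longrightarrow> h (x \<oplus>\<^bsub>A\<^esub> y) = h x \<oplus>\<^bsub>B\<^esub> h y"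
    and h_smult: "\<lbrakk>a \<in> carrier K; x \<in> carrier A\<rbrakk> \<Longrightarrow> h (a \<odot>\<^bsub>A\<^esub> x) = a \<odot>\<^bsub>B\<^esub> h x"
    and h_bracket: "\<lbrakk>x \<in> carrier A; y \<in> carrier A\<rbrakk> \<Longrightarrow> h (bracket A x y) = bracket B (h x) (h y)"
    and bracket_in: "\<lbrakk>x \<in> carrier A; y \<in> carrier A\<rbrakk> \<Longrightarrow> bracket A x y \<in> carrier A"
begin

sublocale A: vectorspace K A
  by (rule vs)

lemma carrier_B: "carrier B = h ` carrier A"
  using bij by (simp add: bij_betw_def)

lemma inj: "inj_on h (carrier A)"
  using bij by (simp add: bij_betw_def)

lemma vectorspace_B: "vectorspace K B"
  using A.module_transport[OF bij h_zero h_add h_smult] by (simp add: vectorspace_def A.field_axioms)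

lemma submodule_image_iff:
  assumes "I \<subseteq> carrier A"
  shows "submodule K (h ` I) B \<longleftrightarrow> submodule K I A"
proof -
  have mem: "h x \<in> h ` I \<longleftrightarrow> x \<in> I" if "x \<in> carrier A" for x
    using that assms inj by (auto simp: inj_on_def)
  have AB: "module K A" "module K B"
    using vectorspace_B by (simp_all add: A.module_axioms vectorspace_def)
  have I: "\<And>x. x \<in> I \<Longrightarrow> x \<in> carrier A"
    using assms by blast
  have "(\<forall>v w. v \<in> h ` I \<longrightarrow> w \<in> h ` I \<longrightarrow> v \<oplus>\<^bsub>B\<^esub> w \<in> h ` I) \<longleftrightarrow>
      (\<forall>v\<in>I. \<forall>w\<in>I. h v \<oplus>\<^bsub>B\<^esub> h w \<in> h ` I)"
    by blast
  also have "\<dots> \<longleftrightarrow> (\<forall>v\<in>I. \<forall>w\<in>I. v \<oplus>\<^bsub>A\<^esub> w \<in> I)"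
    by (simp add: I mem flip: h_add)
  finally have add: "(\<forall>v w. v \<in> h ` I \<longrightarrow> w \<in> h ` I \<longrightarrow> v \<oplus>\<^bsub>B\<^esub> w \<in> h ` I) \<longleftrightarrow>
      (\<forall>v w. v \<in> I \<longrightarrow> w \<in> I \<longrightarrow> v \<oplus>\<^bsub>A\<^esub> w \<in> I)"
    by blast
  have "(\<forall>a v. a \<in> carrier K \<longrightarrow> v \<in> h ` I \<longrightarrow> a \<odot>\<^bsub>B\<^esub> v \<in> h ` I) \<longleftrightarrow>
      (\<forall>a\<in>carrier K. \<forall>v\<in>I. a \<odot>\<^bsub>B\<^esub> h v \<in> h ` I)"
    by blast
  also have "\<dots> \<longleftrightarrow> (\<forall>a\<in>carrier K. \<forall>v\<in>I. a \<odot>\<^bsub>A\<^esub> v \<in> I)"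
    by (simp add: I mem flip: h_smult)
  finally have smult: "(\<forall>a v. a \<in> carrier K \<longrightarrow> v \<in> h ` I \<longrightarrow> a \<odot>\<^bsub>B\<^esub> v \<in> h ` I) \<longleftrightarrow>
      (\<forall>a v. a \<in> carrier K \<longrightarrow> v \<in> I \<longrightarrow> a \<odot>\<^bsub>A\<^esub> v \<in> I)"
    by blast
  have zero: "\<zero>\<^bsub>B\<^esub> \<in> h ` I \<longleftrightarrow> \<zero>\<^bsub>A\<^esub> \<in> I"
    by (simp add: mem flip: h_zero)
  show ?thesis
    unfolding submodule_def add smult zero
    using assms AB by (simp add: carrier_B image_mono)
qed

lemma lie_ideal_image_iff:
  assumes "I \<subseteq> carrier A"
  shows "lie_ideal K B (h ` I) \<longleftrightarrow> lie_ideal K A I"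
proof -
  have mem: "h x \<in> h ` I \<longleftrightarrow> x \<in> I" if "x \<in> carrier A" for x
    using that assms inj by (auto simp: inj_on_def)
  have I: "\<And>x. x \<in> I \<Longrightarrow> x \<in> carrier A"
    using assms by blast
  then show ?thesis
    unfolding lie_ideal_def VectorSpace.subspace_def carrier_B
    by (simp add: submodule_image_iff assms vs vectorspace_B h_bracket[symmetric] mem bracket_in)
qed

text \<open>Taking images under \<open>h\<close> is a bijection between the ideals of
  \<open>A\<close> and those of \<open>B\<close>, and it keeps cardinalities, hence
  codimensions.\<close>

lemma num_ideals_transport:
  assumes "finite (carrier K)" "finite (carrier A)"
  shows "num_ideals K B i = num_ideals K A i"
proof -
  let ?S = "\<lambda>A. {I. lie_ideal K A I \<and> card I * card (carrier K) ^ i = card (carrier A)}"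
  have sub: "lie_ideal K A I \<Longrightarrow> I \<subseteq> carrier A" "lie_ideal K B J \<Longrightarrow> J \<subseteq> carrier B" for I J
    by (auto simp: lie_ideal_def VectorSpace.subspace_def submodule_def)
  have card_image_h: "card (h ` I) = card I" if "I \<subseteq> carrier A" for I
    using that inj by (auto intro: card_image inj_on_subset)
  have "?S B = (`) h ` ?S A"
  proof (intro equalityI subsetI)
    fix J assume J: "J \<in> ?S B"
    then obtain I where "I \<subseteq> carrier A" "J = h ` I"
      using sub(2)[of J] unfolding carrier_B by (auto simp: subset_image_iff)
    with J show "J \<in> (`) h ` ?S A"
      by (auto simp: lie_ideal_image_iff card_image_h carrier_B)
  next
    fix J assume "J \<in> (`) h ` ?S A"
    then show "J \<in> ?S B"
      using sub(1) by (auto simp: lie_ideal_image_iff card_image_h carrier_B)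
  qed
  moreover have "inj_on ((`) h) (?S A)"
    by (rule inj_on_subset[OF inj_on_image_Pow[OF inj]]) (use sub(1) in auto)
  ultimately have "card (?S B) = card (?S A)"
    by (simp add: card_image)
  then show ?thesis
    using assms vs vectorspace_B by (simp add: num_ideals_eq_card carrier_B)
qed

lemma dim_transport:
  assumes "finite (carrier K)" "finite (carrier A)"
  shows "vs_dim K B = vs_dim K A"
proof -
  have "card (carrier B) = card (carrier A)"
    using bij by (simp add: bij_betw_same_card)
  then show ?thesis
    using A.card_carrier_eq_power_dim vectorspace.card_carrier_eq_power_dim[OF vectorspace_B]
      assms A.card_carrier_gt_1 carrier_B by simp
qed

end


subsection \<open>Ideals of the coordinate model\<close>

text \<open>The bracket is the formula of \<open>bracket_Mc\<close> reduced modulo \<open>p\<close>.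
  For \<open>c = 1\<close> it is zero, so the ideals are then all subspaces of a plane.\<close>

definition Mp :: "nat \<Rightarrow> nat \<Rightarrow> (int, nat \<Rightarrow> int) lie_struct" where
  "Mp c p = module.extend (ring.func_space (Fp p) {..c})
     (lie_struct.fields (\<lambda>v w. \<lambda>k\<in>{..c}.
        if 2 \<le> k then (v 0 * w (k - 1) - w 0 * v (k - 1)) mod int p else 0))"

text \<open>The guard \<open>i \<le> c\<close> matters because members are \<open>undefined\<close>
  beyond \<open>c\<close>; with it, and \<open>p\<close> prime, every \<open>k > c\<close> gives the
  zero space.\<close>

definition flag :: "nat \<Rightarrow> nat \<Rightarrow> nat \<Rightarrow> (nat \<Rightarrow> int) set" where
  "flag c p k = {v \<in> {..c} \<rightarrow>\<^sub>E {0..<int p}. \<forall>i<k. i \<le> c \<longrightarrow> v i = 0}"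

text \<open>For \<open>c \<ge> 1\<close> and \<open>p\<close> prime these are the hyperplanes
  through x_2, ..., x_c other than v_0 = 0, indexed by slope; the remaining one is
  \<open>flag c p 1\<close>.\<close>

definition hyperplane :: "nat \<Rightarrow> nat \<Rightarrow> int \<Rightarrow> (nat \<Rightarrow> int) set" where
  "hyperplane c p a = {v \<in> {..c} \<rightarrow>\<^sub>E {0..<int p}. v 1 = (a * v 0) mod int p}"

context residues_prime
begin

lemma ring_Fp: "ring (Fp p)"
  using is_field field.is_ring R_def by simp

lemma carrier_Fp: "carrier (Fp p) = {0..<int p}"
  by (auto simp: residue_ring_def)

lemma finite_carrier_Fp: "finite (carrier (Fp p))"
  and card_carrier_Fp: "card (carrier (Fp p)) = p"
  by (simp_all add: carrier_Fp)

lemma carrier_func_space: "carrier (ring.func_space (Fp p) S) = S \<rightarrow>\<^sub>E {0..<int p}"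
  and zero_func_space: "\<zero>\<^bsub>ring.func_space (Fp p) S\<^esub> = (\<lambda>k\<in>S. 0)"
  and add_func_space: "v \<oplus>\<^bsub>ring.func_space (Fp p) S\<^esub> w = (\<lambda>k\<in>S. (v k + w k) mod int p)"
  and smult_func_space: "a \<odot>\<^bsub>ring.func_space (Fp p) S\<^esub> v = (\<lambda>k\<in>S. a * v k mod int p)"
  unfolding ring.func_space_def[OF ring_Fp]
  by (simp_all add: carrier_Fp) (simp_all add: residue_ring_def)

lemma vectorspace_func_space: "vectorspace (Fp p) (ring.func_space (Fp p) S)"
  using is_field R_def cring.func_space_is_module[of "Fp p" S] cring
  by (simp add: vectorspace_def)

lemma carrier_Mp: "carrier (Mp c p) = {..c} \<rightarrow>\<^sub>E {0..<int p}"
  and zero_Mp: "\<zero>\<^bsub>Mp c p\<^esub> = (\<lambda>k\<in>{..c}. 0)"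
  and add_Mp: "v \<oplus>\<^bsub>Mp c p\<^esub> w = (\<lambda>k\<in>{..c}. (v k + w k) mod int p)"
  and smult_Mp: "a \<odot>\<^bsub>Mp c p\<^esub> v = (\<lambda>k\<in>{..c}. a * v k mod int p)"
  and bracket_Mp: "bracket (Mp c p) v w = (\<lambda>k\<in>{..c}.
        if 2 \<le> k then (v 0 * w (k - 1) - w 0 * v (k - 1)) mod int p else 0)"
  by (simp_all add: Mp_def module.defs lie_struct.defs carrier_func_space zero_func_space
      add_func_space smult_func_space)

lemma vectorspace_Mp: "vectorspace (Fp p) (Mp c p)"
proof -
  interpret V: vectorspace "Fp p" "ring.func_space (Fp p) {..c}"
    by (rule vectorspace_func_space)
  have "module (Fp p) (Mp c p)"
    by (rule V.module_transport[where h = id]) (simp_all add: Mp_def module.defs)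
  then show ?thesis
    by (simp add: vectorspace_def V.field_axioms)
qed

lemma finite_carrier_Mp: "finite (carrier (Mp c p))"
  and card_carrier_Mp: "card (carrier (Mp c p)) = p ^ (c + 1)"
  by (simp_all add: carrier_Mp finite_PiE card_funcsetE)

lemma dim_Mp: "vs_dim (Fp p) (Mp c p) = c + 1"
proof -
  have "p ^ vs_dim (Fp p) (Mp c p) = p ^ (c + 1)"
    using vectorspace.card_carrier_eq_power_dim[OF vectorspace_Mp finite_carrier_Mp]
    unfolding card_carrier_Mp card_carrier_Fp by simp
  then show ?thesis
    using prime_gt_1_nat[OF p_prime] power_inject_exp by blast
qed

lemma subspace_Mp_iff:
  "VectorSpace.subspace (Fp p) W (Mp c p) \<longleftrightarrow>
     W \<subseteq> {..c} \<rightarrow>\<^sub>E {0..<int p} \<and> (\<lambda>k\<in>{..c}. 0) \<in> W \<and>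
     (\<forall>v\<in>W. \<forall>w\<in>W. (\<lambda>k\<in>{..c}. (v k + w k) mod int p) \<in> W) \<and>
     (\<forall>a\<in>{0..<int p}. \<forall>v\<in>W. (\<lambda>k\<in>{..c}. a * v k mod int p) \<in> W)"
  using vectorspace_Mp[of c]
  unfolding VectorSpace.subspace_def submodule_def
  by (auto simp: vectorspace_def carrier_Mp zero_Mp add_Mp smult_Mp carrier_Fp)

lemma mod_in_range: "x mod int p \<in> {0..<int p}"
  using m_gt_one by simp

section \<open>Flag members and hyperplanes: cardinality and ideal property\<close>

lemma card_flag:
  assumes "k \<le> c + 1"
  shows "card (flag c p k) = p ^ (c + 1 - k)"
proof -
  \<comment> \<open>A flag member is a box: each coordinate is independently forced or free.\<close>
  have "flag c p k = PiE {..c} (\<lambda>i. if i < k then {0} else {0..<int p})"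
    using m_gt_one by (auto simp: flag_def PiE_def Pi_def extensional_def split: if_splits)
  then have "card (flag c p k) = (\<Prod>i\<le>c. if i < k then 1 else p)"
    by (auto simp: card_PiE intro!: prod.cong)
  also have "\<dots> = p ^ card {i \<in> {..c}. \<not> i < k}"
    by (simp add: prod.If_cases Int_def conj_commute)
  also have "{i \<in> {..c}. \<not> i < k} = {k..c}"
    by auto
  finally show ?thesis
    by simp
qed

lemma card_hyperplane:
  assumes "1 \<le> c"
  shows "card (hyperplane c p a) = p ^ c"
proof -
  \<comment> \<open>In \<open>flag c p 1\<close> coordinate 0 is forced and coordinate 1 is free;
    view the hyperplane with these roles exchanged. So \<open>?f\<close> moves the free entry to
    slot 0 and fills in the forced one.\<close>
  let ?f = "\<lambda>u. u(0 := u 1, 1 := a * u 1 mod int p)"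
  let ?g = "\<lambda>v. v(0 := 0, 1 := v 0)"
  have "bij_betw ?f (flag c p 1) (hyperplane c p a)"
    by (rule bij_betw_byWitness[where f' = ?g])
       (use assms m_gt_one in \<open>auto simp: flag_def hyperplane_def fun_eq_iff PiE_def Pi_def
          extensional_def\<close>)
  then show ?thesis
    using card_flag[of 1 c] by (simp add: bij_betw_same_card)
qed

text \<open>For \<open>k = 0\<close> this is the whole space. Otherwise y_0 = 0 for each member y,
  so coordinate j of [x, y] is x_0 y_(j-1) when j is at least 2, and it vanishes for all j below
  \<open>k\<close>.\<close>

lemma lie_ideal_flag: "lie_ideal (Fp p) (Mp c p) (flag c p k)"
  unfolding lie_ideal_def subspace_Mp_iff
  using m_gt_one by (auto simp: flag_def bracket_Mp carrier_Mp Pi_def PiE_def)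

text \<open>Every bracket has coordinates 0 and 1 equal to zero, so it satisfies the equation for
  any slope; only linearity of that equation modulo \<open>p\<close> needs work.\<close>

lemma lie_ideal_hyperplane:
  assumes "1 \<le> c"
  shows "lie_ideal (Fp p) (Mp c p) (hyperplane c p a)"
proof -
  have "(b * (a * x mod int p)) mod int p = a * (b * x mod int p) mod int p" for b x
    by (simp add: mod_mult_right_eq mult.left_commute)
  moreover have "(a * x mod int p + a * y mod int p) mod int p =
      a * ((x + y) mod int p) mod int p" for x y
    by (simp add: mod_mult_right_eq mod_add_eq distrib_left)
  ultimately show ?thesis
    unfolding lie_ideal_def subspace_Mp_iff
    using assms m_gt_one by (auto simp: hyperplane_def bracket_Mp carrier_Mp Pi_def PiE_def)
qed

section \<open>Classification of the ideals by row reduction\<close>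

lemma exists_quotient_mod:
  assumes "b \<in> {0..<int p}" "b \<noteq> 0"
  obtains a where "a \<in> {0..<int p}" "a * b mod int p = x mod int p"
proof -
  have "coprime b (int p)"
    using assms p_coprime_right_int zdvd_not_zless[of b "int p"] by force
  then obtain y where "[b * y = 1] (mod int p)"
    using cong_solve_coprime_int by blast
  then have "[(x * y) * b = x] (mod int p)"
    by (metis cong_scalar_left mult.assoc mult.commute mult.right_neutral)
  then have "(x * y mod int p) * b mod int p = x mod int p"
    by (simp add: cong_def mod_mult_left_eq)
  then show ?thesis
    using that mod_in_range by blast
qed

text \<open>One step of row reduction: modulo a known member \<open>w\<close>, membership of
  \<open>u\<close> may be tested on a vector with a chosen coordinate cleared.\<close>

lemma subspace_reduce:
  assumes W: "VectorSpace.subspace (Fp p) W (Mp c p)" and "w \<in> W"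
    and "u \<in> {..c} \<rightarrow>\<^sub>E {0..<int p}" and a: "a \<in> {0..<int p}"
  shows "(\<lambda>k\<in>{..c}. (u k - a * w k) mod int p) \<in> W \<longleftrightarrow> u \<in> W"
proof -
  let ?aw = "\<lambda>a. \<lambda>k\<in>{..c}. a * w k mod int p"
  let ?d = "\<lambda>k\<in>{..c}. (u k - a * w k) mod int p"
  have smult: "?aw b \<in> W" if "b \<in> {0..<int p}" for b
    using W assms(2) that unfolding subspace_Mp_iff by blast
  have add: "(\<lambda>k\<in>{..c}. (v k + v' k) mod int p) \<in> W" if "v \<in> W" "v' \<in> W" for v v'
    using W that unfolding subspace_Mp_iff by blast
  have u: "u k mod int p = u k" if "k \<le> c" for k
    using assms(3) that by (auto simp: PiE_def Pi_def)
  \<comment> \<open>Adding a w back recovers \<open>u\<close>; conversely the difference is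
    \<open>u\<close> plus the multiple of \<open>w\<close> by the residue of -a, as scalars must lie
    in \<open>{0..<int p}\<close>.\<close>
  have "(\<lambda>k\<in>{..c}. (?d k + ?aw a k) mod int p) = u"
    using assms(3) by (auto simp: fun_eq_iff mod_add_eq u PiE_def extensional_def)
  moreover have "(\<lambda>k\<in>{..c}. (u k + ?aw (- a mod int p) k) mod int p) = ?d"
    by (auto simp: fun_eq_iff mod_add_right_eq mod_mult_left_eq mod_simps)
  ultimately show ?thesis
    using add[OF _ smult[OF a], of ?d] add[OF _ smult[OF mod_in_range], of u "- a"]
    by (simp only:) blast
qed

text \<open>The vector \<open>w\<close> has its pivot at \<open>j\<close>. Subtracting from
  \<open>u\<close> the multiple of \<open>w\<close> with factor u_j / w_j clears coordinate
  \<open>j\<close>, so \<open>u\<close> lands in the next flag member, already inside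
  \<open>W\<close>.\<close>

lemma flag_subset_step:
  assumes W: "VectorSpace.subspace (Fp p) W (Mp c p)" and w: "w \<in> W" "w \<in> flag c p j"
    and j: "j \<le> c" "w j \<noteq> 0" and sub: "flag c p (Suc j) \<subseteq> W"
  shows "flag c p j \<subseteq> W"
proof
  fix u assume u: "u \<in> flag c p j"
  have "w j \<in> {0..<int p}"
    using w(2) j by (auto simp: flag_def PiE_def Pi_def)
  then obtain a where a: "a \<in> {0..<int p}" "a * w j mod int p = u j mod int p"
    using exists_quotient_mod j(2) by metis
  have "(u j - a * w j) mod int p = 0"
    using a(2) by (metis mod_diff_right_eq diff_self mod_0 mod_diff_left_eq)
  then have "(\<lambda>k\<in>{..c}. (u k - a * w k) mod int p) \<in> flag c p (Suc j)"
    using u w(2) m_gt_one by (auto simp: flag_def less_Suc_eq PiE_def Pi_def)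
  then show "u \<in> W"
    using subspace_reduce[OF W w(1) _ a(1), of u] u sub by (metis (lifting) flag_def mem_Collect_eq subsetD)
qed

text \<open>Since \<open>k \<ge> 1\<close>, coordinate 0 of \<open>v\<close> is zero and bracketing
  with x_0 is a pure shift. Iterating it produces members of \<open>I\<close> with pivot v_k at each
  position from \<open>k\<close> to \<open>c\<close>.\<close>

lemma flag_subset_lie_ideal:
  assumes I: "lie_ideal (Fp p) (Mp c p) I" and v: "v \<in> I" "v \<in> flag c p k"
    and k: "1 \<le> k" "k \<le> c" "v k \<noteq> 0"
  shows "flag c p k \<subseteq> I"
proof -
  have W: "VectorSpace.subspace (Fp p) I (Mp c p)"
    using I by (simp add: lie_ideal_def)
  let ?x0 = "\<lambda>i\<in>{..c}. if i = 0 then 1 else (0::int)"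
  have x0: "?x0 \<in> carrier (Mp c p)"
    using m_gt_one by (auto simp: carrier_Mp)
  have shift: "\<exists>w\<in>I. w \<in> flag c p (k + n) \<and> w (k + n) = v k" if "k + n \<le> c" for n
    using that
  proof (induction n)
    case 0
    then show ?case using v by auto
  next
    case (Suc n)
    then obtain w where w: "w \<in> I" "w \<in> flag c p (k + n)" "w (k + n) = v k"
      by auto
    have w0: "w 0 = 0"
      using w k by (auto simp: flag_def)
    have "v k \<in> {0..<int p}"
      using v(2) k by (auto simp: flag_def PiE_def Pi_def)
    then have "bracket (Mp c p) ?x0 w \<in> flag c p (k + Suc n)"
      "bracket (Mp c p) ?x0 w (k + Suc n) = v k"
      using w w0 m_gt_one k Suc.prems by (auto simp: bracket_Mp flag_def)
    moreover have "bracket (Mp c p) ?x0 w \<in> I"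
      using I x0 w(1) by (auto simp: lie_ideal_def)
    ultimately show ?case by blast
  qed
  \<comment> \<open>The induction runs downwards from the zero space
    \<open>flag c p (c + 1)\<close>, adjoining at each \<open>j\<close> the shifted vector with
    pivot there.\<close>
  have "flag c p j \<subseteq> I" if "k \<le> j" "j \<le> c + 1" for j
    using that(2,1)
  proof (induction j rule: inc_induct)
    case base
    have "flag c p (c + 1) \<subseteq> {\<lambda>k\<in>{..c}. 0}"
      by (auto simp: flag_def PiE_def extensional_def fun_eq_iff)
    then show ?case
      using W by (auto simp: subspace_Mp_iff)
  next
    case (step j)
    obtain w where "w \<in> I" "w \<in> flag c p j" "w j = v k"
      using shift[of "j - k"] step by auto
    then show ?case
      using flag_subset_step[OF W, of w j] step k by auto
  qed
  then show ?thesis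
    using k by simp
qed

text \<open>The bracket [x_1, v] equals -v_0 x_2, a nonzero multiple of x_2, so the previous lemma
  applies with index 2. For \<open>c < 2\<close> the flag member is zero.\<close>

lemma flag_2_subset_lie_ideal:
  assumes I: "lie_ideal (Fp p) (Mp c p) I" and v: "v \<in> I" "v 0 \<noteq> 0"
  shows "flag c p 2 \<subseteq> I"
proof (cases "2 \<le> c")
  case True
  let ?x1 = "\<lambda>i\<in>{..c}. if i = 1 then 1 else (0::int)"
  let ?w = "bracket (Mp c p) ?x1 v"
  have v0: "v 0 \<in> {0..<int p}"
    using I v(1) unfolding lie_ideal_def subspace_Mp_iff by (auto simp: PiE_def Pi_def)
  have "?x1 \<in> carrier (Mp c p)"
    using m_gt_one by (auto simp: carrier_Mp)
  then have "?w \<in> I"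
    using I v by (auto simp: lie_ideal_def)
  moreover have "?w \<in> flag c p 2"
    using m_gt_one by (auto simp: bracket_Mp flag_def)
  moreover have "?w 2 \<noteq> 0"
    using True v v0 by (auto simp: bracket_Mp zmod_zminus1_eq_if)
  ultimately show ?thesis
    using flag_subset_lie_ideal[OF I] True by auto
next
  case False
  then have "flag c p 2 \<subseteq> {\<lambda>k\<in>{..c}. 0}"
    by (auto simp: flag_def PiE_def extensional_def fun_eq_iff)
  then show ?thesis
    using I by (auto simp: lie_ideal_def subspace_Mp_iff)
qed

lemma lie_ideal_cases:
  assumes I: "lie_ideal (Fp p) (Mp c p) I" and c: "1 \<le> c"
  obtains (flag) k where "k \<le> c + 1" "I = flag c p k"
  | (hyperplane) a where "a \<in> {0..<int p}" "I = hyperplane c p a"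
proof -
  have W: "VectorSpace.subspace (Fp p) I (Mp c p)"
    using I by (simp add: lie_ideal_def)
  have IV: "I \<subseteq> {..c} \<rightarrow>\<^sub>E {0..<int p}"
    using W by (simp add: subspace_Mp_iff)
  consider (zero) "\<forall>v\<in>I. v 0 = 0" | (nonzero) v where "v \<in> I" "v 0 \<noteq> 0"
    by blast
  then show thesis
  proof cases
    case zero
    show thesis
    proof (cases "\<exists>k\<le>c. \<exists>v\<in>I. v k \<noteq> 0")
      case True
      \<comment> \<open>The first index at which some element of \<open>I\<close> is nonzero. It is
        at least 1 because coordinate 0 vanishes on \<open>I\<close>, as
        \<open>flag_subset_lie_ideal\<close> demands.\<close>
      define k where "k = (LEAST k. k \<le> c \<and> (\<exists>v\<in>I. v k \<noteq> 0))"
      have k: "k \<le> c" "\<exists>v\<in>I. v k \<noteq> 0"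
        using LeastI_ex[OF True] by (simp_all add: k_def)
      have below: "v i = 0" if "i < k" "v \<in> I" for v i
        using not_less_Least[of i "\<lambda>k. k \<le> c \<and> (\<exists>v\<in>I. v k \<noteq> 0)"] that k(1) by (auto simp: k_def)
      have "I \<subseteq> flag c p k"
        using IV below by (auto simp: flag_def)
      moreover have "1 \<le> k"
        using k(2) zero by (cases k) auto
      ultimately have "I = flag c p k"
        using flag_subset_lie_ideal[OF I] k by blast
      then show thesis
        using k(1) by (intro flag[of k]) auto
    next
      case False
      then have "I \<subseteq> {\<lambda>k\<in>{..c}. 0}"
        using IV by (auto simp: PiE_def extensional_def fun_eq_iff)
      then have "I = {\<lambda>k\<in>{..c}. 0}"
        using W by (auto simp: subspace_Mp_iff)
      moreover have "flag c p (c + 1) = {\<lambda>k\<in>{..c}. 0}"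
        using m_gt_one by (auto simp: flag_def PiE_def extensional_def fun_eq_iff)
      ultimately show thesis
        using flag by blast
    qed
  next
    case nonzero
    have f2: "flag c p 2 \<subseteq> I"
      by (rule flag_2_subset_lie_ideal[OF I nonzero])
    have v: "v 0 \<in> {0..<int p}" "v \<in> {..c} \<rightarrow>\<^sub>E {0..<int p}"
      using IV nonzero by (auto simp: PiE_def Pi_def)
    \<comment> \<open>The slope v_1 / v_0 of \<open>v\<close>. Only the hyperplane with this slope
      contains \<open>v\<close>, so it is the only one that can contain \<open>I\<close>.\<close>
    obtain a where a: "a \<in> {0..<int p}" "a * v 0 mod int p = v 1 mod int p"
      using exists_quotient_mod[OF v(1) nonzero(2)] by metis
    let ?d = "\<lambda>u b. \<lambda>k\<in>{..c}. (u k - b * v k) mod int p"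
    \<comment> \<open>With b = u_0 / v_0, subtracting b v clears coordinate 0 and leaves in
      coordinate 1 the defect u_1 - a u_0, which vanishes modulo \<open>p\<close> exactly on the
      hyperplane of slope \<open>a\<close>.\<close>
    have diff: "?d u b 0 = 0 \<and> ?d u b 1 = (u 1 - a * u 0) mod int p"
      if b: "b * v 0 mod int p = u 0 mod int p" for u b
    proof -
      have p: "int p dvd b * v 0 - u 0" "int p dvd a * v 0 - v 1"
        using a b by (simp_all add: mod_eq_dvd_iff)
      have "(u 1 - b * v 1) - (u 1 - a * u 0) = b * (a * v 0 - v 1) - a * (b * v 0 - u 0)"
        by (simp add: algebra_simps)
      then have "(u 1 - b * v 1) mod int p = (u 1 - a * u 0) mod int p"
        using p by (simp add: mod_eq_dvd_iff)
      moreover have "(u 0 - b * v 0) mod int p = 0"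
        using p(1) by (simp add: dvd_diff_commute)
      ultimately show ?thesis
        using c by simp
    qed
    show thesis
    proof (cases "I \<subseteq> hyperplane c p a")
      case True
      \<comment> \<open>A point of the hyperplane reduces modulo \<open>v\<close> into
        \<open>flag c p 2\<close>, which lies in \<open>I\<close>.\<close>
      have "u \<in> I" if u: "u \<in> hyperplane c p a" for u
      proof -
        obtain b where b: "b \<in> {0..<int p}" "b * v 0 mod int p = u 0 mod int p"
          using exists_quotient_mod[OF v(1) nonzero(2)] by metis
        have "(u 1 - a * u 0) mod int p = 0"
          using u by (auto simp: hyperplane_def mod_diff_left_eq)
        then have "?d u b \<in> flag c p 2"
          using diff[of b u, OF b(2)] m_gt_one
          by (auto simp: flag_def less_2_cases_iff)
        then show ?thesis
          using f2 subspace_reduce[OF W nonzero(1) _ b(1)] u by (auto simp: hyperplane_def)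
      qed
      then show thesis
        using True a hyperplane by blast
    next
      case False
      \<comment> \<open>An element off the hyperplane reduces to a vector with pivot at 1. With
        \<open>flag c p 2\<close> it yields \<open>flag c p 1\<close>, and \<open>v\<close>, with
        pivot at 0, then yields the whole space.\<close>
      then obtain u where u: "u \<in> I" "u 1 \<noteq> a * u 0 mod int p"
        using IV by (auto simp: hyperplane_def)
      obtain b where b: "b \<in> {0..<int p}" "b * v 0 mod int p = u 0 mod int p"
        using exists_quotient_mod[OF v(1) nonzero(2)] by metis
      have uV: "u \<in> {..c} \<rightarrow>\<^sub>E {0..<int p}" "u 1 mod int p = u 1"
        using u IV c by (auto simp: PiE_def Pi_def)
      have "(u 1 - a * u 0) mod int p \<noteq> 0"
        using u(2) uV(2) by (metis mod_eq_dvd_iff dvd_eq_mod_eq_0)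
      then have d: "?d u b \<in> I" "?d u b \<in> flag c p 1" "?d u b 1 \<noteq> 0"
        using subspace_reduce[OF W nonzero(1) uV(1) b(1)] u diff[of b u, OF b(2)] m_gt_one
        by (auto simp: flag_def)
      then have "flag c p 1 \<subseteq> I"
        using flag_subset_step[OF W d(1,2)] f2 c by (simp add: numeral_2_eq_2)
      then have "flag c p 0 \<subseteq> I"
        using flag_subset_step[OF W nonzero(1), of 0] v nonzero(2) by (simp add: flag_def)
      then have "I = flag c p 0"
        using IV by (auto simp: flag_def)
      then show thesis
        using flag by blast
    qed
  qed
qed

section \<open>Counting ideals by codimension\<close>

lemma inj_on_hyperplane:
  assumes "1 \<le> c"
  shows "inj_on (hyperplane c p) {0..<int p}"
proof (rule inj_onI)
  fix a b assume a: "a \<in> {0..<int p}" "b \<in> {0..<int p}" and eq: "hyperplane c p a = hyperplane c p b"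
  \<comment> \<open>The vector x_0 + a x_1 reveals the slope as its coordinate 1.\<close>
  have "(\<lambda>k\<in>{..c}. if k = 0 then 1 else if k = 1 then a else 0) \<in> hyperplane c p a"
    using assms a m_gt_one by (auto simp: hyperplane_def)
  then have "(\<lambda>k\<in>{..c}. if k = 0 then 1 else if k = 1 then a else 0) \<in> hyperplane c p b"
    by (simp only: eq)
  then show "a = b"
    using assms a by (simp add: hyperplane_def)
qed

lemma hyperplane_neq_flag:
  assumes "1 \<le> c"
  shows "hyperplane c p a \<noteq> flag c p 1"
proof -
  have "(\<lambda>k\<in>{..c}. if k = 0 then 1 else if k = 1 then a mod int p else 0) \<in> hyperplane c p a - flag c p 1"
    using assms m_gt_one by (auto simp: hyperplane_def flag_def)
  then show ?thesis by blast
qed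

text \<open>By size, exactly one flag member has codimension \<open>i\<close>, while all
  \<open>p\<close> hyperplanes have codimension 1; \<open>inj_on_hyperplane\<close> and
  \<open>hyperplane_neq_flag\<close> exclude double counting.\<close>

lemma num_ideals_Mp:
  assumes c: "1 \<le> c" and i: "i \<le> c + 1"
  shows "num_ideals (Fp p) (Mp c p) i = (if i = 1 then p + 1 else 1)"
proof -
  let ?S = "{I. lie_ideal (Fp p) (Mp c p) I \<and> card I * p ^ i = p ^ (c + 1)}"
  have p: "1 < p"
    using m_gt_one by simp
  have flag_iff: "card (flag c p k) * p ^ i = p ^ (c + 1) \<longleftrightarrow> k = i" if "k \<le> c + 1" for k
  proof -
    have "card (flag c p k) * p ^ i = p ^ (c + 1 - k + i)"
      by (simp only: card_flag[OF that] power_add)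
    then show ?thesis
      using p that by (auto simp: power_inject_exp simp del: power_Suc)
  qed
  have hyp_iff: "card (hyperplane c p a) * p ^ i = p ^ (c + 1) \<longleftrightarrow> i = 1" for a
  proof -
    have "card (hyperplane c p a) * p ^ i = p ^ (c + i)"
      by (simp only: card_hyperplane[OF c] power_add)
    then show ?thesis
      using p by (auto simp: power_inject_exp simp del: power_Suc)
  qed
  have "?S = insert (flag c p i) (if i = 1 then hyperplane c p ` {0..<int p} else {})"
  proof (intro equalityI subsetI)
    fix I assume "I \<in> ?S"
    then have I: "lie_ideal (Fp p) (Mp c p) I" "card I * p ^ i = p ^ (c + 1)"
      by auto
    from I(1) c show "I \<in> insert (flag c p i) (if i = 1 then hyperplane c p ` {0..<int p} else {})"
      by (cases rule: lie_ideal_cases) (use I(2) flag_iff hyp_iff in auto)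
  next
    fix I assume "I \<in> insert (flag c p i) (if i = 1 then hyperplane c p ` {0..<int p} else {})"
    then show "I \<in> ?S"
      using lie_ideal_flag lie_ideal_hyperplane[OF c] flag_iff[OF i] hyp_iff
      by (auto split: if_splits)
  qed
  moreover have "flag c p 1 \<notin> hyperplane c p ` {0..<int p}"
    using hyperplane_neq_flag[OF c] by force
  ultimately have "card ?S = (if i = 1 then p + 1 else 1)"
    by (simp add: card_image[OF inj_on_hyperplane[OF c]])
  then show ?thesis
    using num_ideals_eq_card[OF vectorspace_Mp finite_carrier_Fp finite_carrier_Mp]
    unfolding card_carrier_Mp card_carrier_Fp by simp
qed

text \<open>The bracket of \<open>Mp 1 p\<close> vanishes, so its ideals are the subspaces of the
  plane and the classification serves a second time. Dimension \<open>i\<close> is codimension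
  \<open>2 - i\<close>, and the count is symmetric under this exchange.\<close>

lemma gaussian_binomial_2:
  assumes "i \<le> 2"
  shows "gaussian_binomial p 2 i = (if i = 1 then p + 1 else 1)"
proof -
  let ?V = "ring.func_space (Fp p) {..<2::nat}"
  have two: "{..<2::nat} = {..1}"
    by auto
  interpret V: vectorspace "Fp p" ?V
    by (rule vectorspace_func_space)
  interpret M: vectorspace "Fp p" "Mp 1 p"
    by (rule vectorspace_Mp)
  have finV: "finite (carrier ?V)"
    by (simp add: carrier_func_space finite_PiE)
  have sub_iff: "VectorSpace.subspace (Fp p) W ?V \<longleftrightarrow> lie_ideal (Fp p) (Mp 1 p) W" for W
  proof -
    have "VectorSpace.subspace (Fp p) W ?V \<longleftrightarrow> VectorSpace.subspace (Fp p) W (Mp 1 p)"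
      using V.vectorspace_axioms M.vectorspace_axioms V.module_axioms M.module_axioms
      by (simp add: VectorSpace.subspace_def submodule_def two carrier_func_space zero_func_space
          add_func_space smult_func_space carrier_Mp zero_Mp add_Mp smult_Mp)
    moreover have "bracket (Mp 1 p) v w = \<zero>\<^bsub>Mp 1 p\<^esub>" for v w
      by (auto simp: bracket_Mp zero_Mp)
    ultimately show ?thesis
      by (auto simp: lie_ideal_def VectorSpace.subspace_def submodule_def)
  qed
  have "vs_dim (Fp p) (?V\<lparr>carrier := W\<rparr>) = i \<longleftrightarrow>
      vs_dim (Fp p) ((Mp 1 p)\<lparr>carrier := W\<rparr>) + (2 - i) = vs_dim (Fp p) (Mp 1 p)"
    if W: "lie_ideal (Fp p) (Mp 1 p) W" for W
  proof -
    have "p ^ vs_dim (Fp p) (?V\<lparr>carrier := W\<rparr>) = p ^ vs_dim (Fp p) ((Mp 1 p)\<lparr>carrier := W\<rparr>)"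
      using V.card_subspace_eq_power_dim[OF finV, of W] W sub_iff
        M.card_subspace_eq_power_dim[OF finite_carrier_Mp, of W]
      unfolding card_carrier_Fp by (simp add: lie_ideal_def)
    then have "vs_dim (Fp p) (?V\<lparr>carrier := W\<rparr>) = vs_dim (Fp p) ((Mp 1 p)\<lparr>carrier := W\<rparr>)"
      using m_gt_one power_inject_exp by auto
    then show ?thesis
      using assms by (auto simp: dim_Mp)
  qed
  then have "gaussian_binomial p 2 i = num_ideals (Fp p) (Mp 1 p) (2 - i)"
    unfolding gaussian_binomial_def num_ideals_def Let_def sub_iff
    by (intro arg_cong[where f = card]) auto
  then show ?thesis
    using num_ideals_Mp[of 1 "2 - i"] assms by auto
qed

end


subsection \<open>Tensor products as quotients of free abelian groups\<close>

text \<open>The homomorphism from formal sums to the integers with value \<open>w q\<close> on the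
  generator \<open>q\<close>. Values stay integers; reduction modulo \<open>p\<close> enters only
  through congruences.\<close>

definition frag_eval :: "('a \<Rightarrow> int) \<Rightarrow> ('a \<Rightarrow>\<^sub>0 int) \<Rightarrow> int" where
  "frag_eval w f = (\<Sum>q\<in>Poly_Mapping.keys f. Poly_Mapping.lookup f q * w q)"

lemma frag_eval_0 [simp]: "frag_eval w 0 = 0"
  by (simp add: frag_eval_def)

lemma frag_eval_of [simp]: "frag_eval w (frag_of q) = w q"
  by (simp add: frag_eval_def)

lemma frag_eval_add: "frag_eval w (f + g) = frag_eval w f + frag_eval w g"
  unfolding frag_eval_def
  by (rule setsum_keys_plus_distrib[where f = "\<lambda>q n. n * w q"]) (simp_all add: distrib_right)

lemma frag_eval_cmul: "frag_eval w (frag_cmul n f) = n * frag_eval w f"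
proof (cases "n = 0")
  case False
  then have "Poly_Mapping.keys (frag_cmul n f) = Poly_Mapping.keys f"
    by auto
  then show ?thesis
    by (simp add: frag_eval_def sum_distrib_left mult.assoc)
qed simp

lemma frag_eval_diff: "frag_eval w (f - g) = frag_eval w f - frag_eval w g"
  using frag_eval_add[of w f "- g"] frag_eval_cmul[of w "-1" g] by simp

lemma frag_eval_sum: "frag_eval w (sum f I) = (\<Sum>i\<in>I. frag_eval w (f i))"
  by (induction I rule: infinite_finite_induct) (simp_all add: frag_eval_add)

text \<open>The scalar action and the bracket of \<open>base_change\<close> are built from
  \<open>frag_extend\<close>; this rule yields their coordinates.\<close>

lemma frag_eval_extend: "frag_eval w (frag_extend b f) = frag_eval (\<lambda>q. frag_eval w (b q)) f"
  by (simp add: frag_extend_def frag_eval_sum frag_eval_cmul) (simp add: frag_eval_def)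

lemma frag_eval_mult_left: "frag_eval (\<lambda>q. x * w q) f = x * frag_eval w f"
  by (simp add: frag_eval_def sum_distrib_left mult.left_commute)

lemma frag_eval_mult_right: "frag_eval (\<lambda>q. w q * x) f = frag_eval w f * x"
  by (simp add: frag_eval_def sum_distrib_right mult.assoc)

lemma frag_eval_diff_left: "frag_eval (\<lambda>q. v q - w q) f = frag_eval v f - frag_eval w f"
  by (simp add: frag_eval_def sum_subtractf right_diff_distrib)

text \<open>Symbols carry products already reduced modulo \<open>p\<close>; this allows replacing
  them by unreduced, multilinear ones.\<close>

lemma frag_eval_cong:
  assumes "\<And>q. q \<in> Poly_Mapping.keys f \<Longrightarrow> [v q = w q] (mod m)"
  shows "[frag_eval v f = frag_eval w f] (mod m)"
  unfolding frag_eval_def by (intro cong_sum cong_mult cong_refl assms)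

section \<open>The subgroup of tensor relations and its cosets\<close>

locale tensor_product = L: abelian_group L + S: abelian_group S
  for L :: "(int, 'a, 'm) module_scheme" and S :: "('s, 'n) ring_scheme"
begin

abbreviation "G \<equiv> free_Abelian_group (carrier L \<times> carrier S)"

lemma relations_subset: "tensor_relations L S \<subseteq> carrier G"
  by (auto simp: tensor_relations_def dest!: subsetD[OF keys_diff])

lemma kernel_subgroup: "subgroup (tensor_kernel L S) G"
  unfolding tensor_kernel_def
  by (rule group.generate_is_subgroup[OF group_free_Abelian_group relations_subset])

lemma kernel_normal: "tensor_kernel L S \<lhd> G"
  by (rule comm_group.subgroup_imp_normal[OF abelian_free_Abelian_group kernel_subgroup])

lemma kernel_subset: "f \<in> tensor_kernel L S \<Longrightarrow> f \<in> carrier G"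
  using subgroup.subset[OF kernel_subgroup] by blast

lemma kernel_0: "0 \<in> tensor_kernel L S"
  using subgroup.one_closed[OF kernel_subgroup] by simp

lemma kernel_add: "f \<in> tensor_kernel L S \<Longrightarrow> g \<in> tensor_kernel L S \<Longrightarrow> f + g \<in> tensor_kernel L S"
  using subgroup.m_closed[OF kernel_subgroup] by simp

lemma kernel_minus: "f \<in> tensor_kernel L S \<Longrightarrow> - f \<in> tensor_kernel L S"
  using subgroup.m_inv_closed[OF kernel_subgroup] kernel_subset by fastforce

lemma kernel_diff: "f \<in> tensor_kernel L S \<Longrightarrow> g \<in> tensor_kernel L S \<Longrightarrow> f - g \<in> tensor_kernel L S"
  using kernel_add[of f "- g"] kernel_minus[of g] by simp

lemma kernel_sum: "(\<And>i. i \<in> I \<Longrightarrow> f i \<in> tensor_kernel L S) \<Longrightarrow> sum f I \<in> tensor_kernel L S"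
  by (induction I rule: infinite_finite_induct) (auto intro: kernel_add kernel_0)

lemma kernel_cmul: "f \<in> tensor_kernel L S \<Longrightarrow> frag_cmul n f \<in> tensor_kernel L S"
  by (rule frag_closure_minus_cmul[where P = "\<lambda>f. f \<in> tensor_kernel L S"])
     (auto intro: kernel_0 kernel_diff)

lemma kernel_add_left:
  "\<lbrakk>a \<in> carrier L; b \<in> carrier L; r \<in> carrier S\<rbrakk>
    \<Longrightarrow> frag_of (a \<oplus>\<^bsub>L\<^esub> b, r) - frag_of (a, r) - frag_of (b, r) \<in> tensor_kernel L S"
  unfolding tensor_kernel_def tensor_relations_def by (rule generate.incl) blast

lemma kernel_add_right:
  "\<lbrakk>a \<in> carrier L; r \<in> carrier S; s \<in> carrier S\<rbrakk>
    \<Longrightarrow> frag_of (a, r \<oplus>\<^bsub>S\<^esub> s) - frag_of (a, r) - frag_of (a, s) \<in> tensor_kernel L S"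
  unfolding tensor_kernel_def tensor_relations_def by (rule generate.incl) blast

text \<open>A map on the integers that is additive modulo the kernel is determined by its value at
  1. It serves both tensor factors: residues in \<open>kernel_mod\<close> and multiples of a basis
  vector in \<open>kernel_frag_of\<close>.\<close>

lemma kernel_additive_imp_cmul:
  assumes "\<And>m n. \<phi> (m + n) - \<phi> m - \<phi> n \<in> tensor_kernel L S"
  shows "\<phi> n - frag_cmul n (\<phi> 1) \<in> tensor_kernel L S"
proof (induction n rule: int_induct[where k = 0])
  case base
  show ?case
    \<comment> \<open>Additivity at 0 + 0 says that -\<phi>(0) is in the kernel.\<close>
    using kernel_minus[OF assms[of 0 0]] by simp
next
  case (step1 i)
  have "\<phi> (i + 1) - frag_cmul (i + 1) (\<phi> 1) =
      (\<phi> (i + 1) - \<phi> i - \<phi> 1) + (\<phi> i - frag_cmul i (\<phi> 1))"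
    by (simp add: frag_cmul_distrib)
  then show ?case
    using kernel_add[OF assms[of i 1] step1(2)] by (simp only:)
next
  case (step2 i)
  have "\<phi> (i - 1) - frag_cmul (i - 1) (\<phi> 1) =
      (\<phi> i - frag_cmul i (\<phi> 1)) - (\<phi> (i - 1 + 1) - \<phi> (i - 1) - \<phi> 1)"
    by (simp add: frag_cmul_diff_distrib)
  then show ?case
    using kernel_diff[OF step2(2) assms] by (simp only:)
qed

lemma class_def: "tensor_class L S f = (\<lambda>k. k + f) ` tensor_kernel L S"
  by (auto simp: tensor_class_def r_coset_def)

lemma mem_class_iff: "g \<in> tensor_class L S f \<longleftrightarrow> g - f \<in> tensor_kernel L S"
  by (force simp: class_def image_iff)

lemma class_eq_iff: "tensor_class L S f = tensor_class L S g \<longleftrightarrow> f - g \<in> tensor_kernel L S"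
proof
  assume "tensor_class L S f = tensor_class L S g"
  then show "f - g \<in> tensor_kernel L S"
    using mem_class_iff[of f f] mem_class_iff[of f g] kernel_0 by simp
next
  assume fg: "f - g \<in> tensor_kernel L S"
  have "h - f \<in> tensor_kernel L S \<longleftrightarrow> h - g \<in> tensor_kernel L S" for h
    using kernel_add[OF _ fg, of "h - f"] kernel_diff[OF _ fg, of "h - g"] by auto
  then show "tensor_class L S f = tensor_class L S g"
    by (auto simp: mem_class_iff)
qed

lemma class_subset: "f \<in> carrier G \<Longrightarrow> g \<in> tensor_class L S f \<Longrightarrow> g \<in> carrier G"
  using kernel_subset[of "g - f"] keys_add[of "g - f" f] by (auto simp: mem_class_iff)

lemma frag_extend_carrier:
  assumes "f \<in> carrier G"
    and "\<And>a r. \<lbrakk>a \<in> carrier L; r \<in> carrier S\<rbrakk> \<Longrightarrow> b (a, r) \<in> carrier (free_Abelian_group T)"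
  shows "frag_extend b f \<in> carrier (free_Abelian_group T)"
proof -
  have "Poly_Mapping.keys (b q) \<subseteq> T" if "q \<in> Poly_Mapping.keys f" for q
  proof -
    have "q \<in> carrier L \<times> carrier S"
      using assms(1) that by auto
    then show ?thesis
      using assms(2)[of "fst q" "snd q"] by auto
  qed
  then show ?thesis
    using keys_frag_extend[of b f] unfolding carrier_free_Abelian_group_iff by blast
qed

lemma carrier_tensor_group: "carrier (tensor_group L S) = tensor_class L S ` carrier G"
  by (auto simp: tensor_group_def FactGroup_def RCOSETS_def tensor_class_def)

lemma one_tensor_group: "\<one>\<^bsub>tensor_group L S\<^esub> = tensor_class L S 0"
  by (simp add: tensor_group_def FactGroup_def class_def)

lemma mult_tensor_group:
  "\<lbrakk>f \<in> carrier G; g \<in> carrier G\<rbrakk> \<Longrightarrow>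
    tensor_class L S f \<otimes>\<^bsub>tensor_group L S\<^esub> tensor_class L S g = tensor_class L S (f + g)"
  using normal.rcos_sum[OF kernel_normal, of f g]
  by (simp add: tensor_group_def FactGroup_def tensor_class_def)

end

text \<open>An integer attached to a formal sum; on classes of the tensor product only its residue
  modulo \<open>p\<close> is well defined.\<close>

definition coord :: "nat \<Rightarrow> ((nat \<Rightarrow> int) \<times> int \<Rightarrow>\<^sub>0 int) \<Rightarrow> int" where
  "coord k = frag_eval (\<lambda>(a, r). a k * r)"

definition basis_vec :: "nat \<Rightarrow> nat \<Rightarrow> nat \<Rightarrow> int" where
  "basis_vec c k = (\<lambda>i\<in>{..c}. if i = k then 1 else 0)"

text \<open>The normal form of a tensor. The entries v_k are coefficients in the free abelian group,
  not second components of symbols, so it is exactly linear in \<open>v\<close>.\<close>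

definition vec_tensor :: "nat \<Rightarrow> (nat \<Rightarrow> int) \<Rightarrow> ((nat \<Rightarrow> int) \<times> int \<Rightarrow>\<^sub>0 int)" where
  "vec_tensor c v = (\<Sum>k\<le>c. frag_cmul (v k) (frag_of (basis_vec c k, 1)))"

lemma coord_vec_tensor:
  assumes "k \<le> c"
  shows "coord k (vec_tensor c v) = v k"
proof -
  have "coord k (vec_tensor c v) = (\<Sum>i\<le>c. v i * (if k = i then 1 else 0))"
    using assms by (simp add: coord_def vec_tensor_def frag_eval_sum frag_eval_cmul basis_vec_def)
  also have "\<dots> = (\<Sum>i\<le>c. if k = i then v i else 0)"
    by (intro sum.cong) auto
  also have "\<dots> = v k"
    using assms by simp
  finally show ?thesis .
qed

lemma vec_tensor_diff:
  "vec_tensor c (\<lambda>k. v k - w k) = vec_tensor c v - vec_tensor c w"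
  by (simp add: vec_tensor_def frag_cmul_diff_distrib sum_subtractf)

context residues_prime
begin

lemma tensor_product_Mc: "tensor_product (Mc c) (Fp p)"
proof -
  have "module \<Z> (Mc c)"
    using lie_algebra_Mc by (rule lie_algebra.axioms)
  then show ?thesis
    using abelian_group R_def by (simp add: tensor_product_def module_def)
qed

end

section \<open>Identification of the tensor product with the coordinate model\<close>

locale mc_tensor = residues_prime p for p :: nat + fixes c :: nat
begin

sublocale tensor_product "Mc c" "Fp p"
  by (rule tensor_product_Mc)

abbreviation "\<K> \<equiv> tensor_kernel (Mc c) (Fp p)"
abbreviation "cls \<equiv> tensor_class (Mc c) (Fp p)"

lemma add_Fp: "r \<oplus>\<^bsub>Fp p\<^esub> s = (r + s) mod int p"
  and mult_Fp: "r \<otimes>\<^bsub>Fp p\<^esub> s = r * s mod int p"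
  by (simp_all add: residue_ring_def)

lemma coord_relation:
  assumes "f \<in> tensor_relations (Mc c) (Fp p)" "k \<le> c"
  shows "[coord k f = 0] (mod int p)"
  using assms(1) unfolding tensor_relations_def
proof (elim UnE CollectE exE conjE)
  fix a b r
  assume "f = frag_of (a \<oplus>\<^bsub>Mc c\<^esub> b, r) - frag_of (a, r) - frag_of (b, r)"
  then have "coord k f = 0"
    using assms(2) by (simp add: coord_def frag_eval_diff add_Mc distrib_right)
  then show ?thesis
    by simp
next
  fix a r s
  assume "f = frag_of (a, r \<oplus>\<^bsub>Fp p\<^esub> s) - frag_of (a, r) - frag_of (a, s)"
  then have "coord k f = a k * ((r + s) mod int p) - a k * r - a k * s"
    by (simp add: coord_def frag_eval_diff add_Fp)
  also have "[\<dots> = a k * (r + s) - a k * r - a k * s] (mod int p)"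
    by (intro cong_diff cong_mult cong_refl) simp
  finally show ?thesis
    by (simp add: distrib_left)
qed

lemma coord_kernel:
  assumes "f \<in> \<K>" "k \<le> c"
  shows "[coord k f = 0] (mod int p)"
  using assms(1) unfolding tensor_kernel_def
proof induction
  case (incl f)
  then show ?case
    using coord_relation assms(2) by blast
next
  case (inv f)
  have "inv\<^bsub>G\<^esub> f = - f"
    using inv relations_subset by auto
  moreover have "coord k (- f) = - coord k f"
    using frag_eval_diff[of _ 0 f] by (simp add: coord_def)
  ultimately show ?case
    using coord_relation[OF inv assms(2)] by (simp add: cong_0_iff)
next
  case (eng f g)
  then show ?case
    by (simp add: coord_def frag_eval_add cong_0_iff)
qed (simp add: coord_def)

lemma basis_vec_carrier: "basis_vec c k \<in> carrier (Mc c)"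
  by (simp add: basis_vec_def carrier_Mc)

lemma one_carrier: "1 \<in> carrier (Fp p)"
  using m_gt_one by (simp add: carrier_Fp)

lemma kernel_mod:
  assumes "a \<in> carrier (Mc c)"
  shows "frag_of (a, n mod int p) - frag_cmul n (frag_of (a, 1)) \<in> \<K>"
proof -
  have "frag_of (a, (m + n) mod int p) - frag_of (a, m mod int p) - frag_of (a, n mod int p) \<in> \<K>"
    for m n
    using kernel_add_right[OF assms, of "m mod int p" "n mod int p"] mod_in_range
    by (simp add: carrier_Fp add_Fp mod_add_eq)
  from kernel_additive_imp_cmul[OF this, of n] show ?thesis
    using m_gt_one by simp
qed

text \<open>Build \<open>a\<close> up one coordinate at a time, turning each a_k x_k \<otimes> r
  into the multiple a_k (x_k \<otimes> r); then \<open>kernel_mod\<close> moves \<open>r\<close> out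
  of the symbol.\<close>

lemma kernel_frag_of:
  assumes a: "a \<in> carrier (Mc c)" and r: "r \<in> carrier (Fp p)"
  shows "frag_of (a, r) - vec_tensor c (\<lambda>k. a k * r) \<in> \<K>"
proof -
  define tr where "tr m = (\<lambda>i\<in>{..c}. if i < m then a i else 0)" for m
  let ?e = "\<lambda>k n. \<lambda>i\<in>{..c}. n * basis_vec c k i"
  have carr: "tr m \<in> carrier (Mc c)" "?e k n \<in> carrier (Mc c)" for m k n
    by (simp_all add: carrier_Mc tr_def)
  have multiple: "frag_of (?e k n, r) - frag_cmul n (frag_of (basis_vec c k, r)) \<in> \<K>" for k n
  proof -
    have "frag_of (?e k (m + n), r) - frag_of (?e k m, r) - frag_of (?e k n, r) \<in> \<K>" for m n
    proof -
      have "?e k (m + n) = ?e k m \<oplus>\<^bsub>Mc c\<^esub> ?e k n"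
        by (auto simp: add_Mc fun_eq_iff distrib_right)
      then show ?thesis
        using kernel_add_left[OF carr(2) carr(2) r] by simp
    qed
    from kernel_additive_imp_cmul[where \<phi> = "\<lambda>n. frag_of (?e k n, r)", OF this, of n]
    have "frag_of (?e k n, r) - frag_cmul n (frag_of (?e k 1, r)) \<in> \<K>" .
    moreover have "?e k 1 = basis_vec c k"
      by (auto simp: basis_vec_def)
    ultimately show ?thesis
      by (simp only:)
  qed
  have trunc: "frag_of (tr m, r) - (\<Sum>k<m. frag_cmul (a k) (frag_of (basis_vec c k, r))) \<in> \<K>"
    if "m \<le> Suc c" for m
    using that
  proof (induction m)
    case 0
    \<comment> \<open>The relation for 0 + 0 = 0 reads -(0 \<otimes> r), so the empty truncation is
      in the kernel.\<close>
    have "\<zero>\<^bsub>Mc c\<^esub> \<oplus>\<^bsub>Mc c\<^esub> \<zero>\<^bsub>Mc c\<^esub> = \<zero>\<^bsub>Mc c\<^esub>"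
      by (auto simp: add_Mc zero_Mc)
    then have "- frag_of (\<zero>\<^bsub>Mc c\<^esub>, r) \<in> \<K>"
      using kernel_add_left[of "\<zero>\<^bsub>Mc c\<^esub>" "\<zero>\<^bsub>Mc c\<^esub>", OF _ _ r] by simp
    then show ?case
      using kernel_minus[of "- frag_of (\<zero>\<^bsub>Mc c\<^esub>, r)"] by (simp add: zero_Mc tr_def restrict_def)
  next
    case (Suc m)
    have "tr (Suc m) = tr m \<oplus>\<^bsub>Mc c\<^esub> ?e m (a m)"
      by (auto simp: add_Mc fun_eq_iff basis_vec_def less_Suc_eq tr_def)
    then have "frag_of (tr (Suc m), r) - frag_of (tr m, r) - frag_of (?e m (a m), r) \<in> \<K>"
      using kernel_add_left[OF carr(1) carr(2) r] by simp
    from kernel_add[OF kernel_add[OF this multiple[of "a m" m]] Suc.IH] Suc.prems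
    show ?case
      by (simp add: algebra_simps)
  qed
  have "frag_cmul (a k) (frag_of (basis_vec c k, r)) - frag_cmul (a k * r) (frag_of (basis_vec c k, 1)) \<in> \<K>"
    for k
    using kernel_cmul[OF kernel_mod[OF basis_vec_carrier[of k], of r], of "a k"] r
    by (simp add: carrier_Fp frag_cmul_distrib2 diff_conv_add_uminus del: add_uminus_conv_diff)
  then have "(\<Sum>k\<le>c. frag_cmul (a k) (frag_of (basis_vec c k, r))) - vec_tensor c (\<lambda>k. a k * r) \<in> \<K>"
    unfolding vec_tensor_def sum_subtractf[symmetric] by (rule kernel_sum)
  moreover have "tr (Suc c) = a"
    using a by (auto simp: carrier_Mc PiE_def extensional_def fun_eq_iff tr_def)
  ultimately show ?thesis
    using kernel_add[OF trunc[of "Suc c"]] by (fastforce simp: lessThan_Suc_atMost)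
qed

text \<open>The expression is additive in \<open>f\<close>, so generators suffice, and those are
  \<open>kernel_frag_of\<close>.\<close>

lemma kernel_normal_form:
  assumes "f \<in> carrier G"
  shows "f - vec_tensor c (\<lambda>k. coord k f) \<in> \<K>"
proof (rule free_Abelian_group_induct[of f "carrier (Mc c) \<times> carrier (Fp p)"])
  show "Poly_Mapping.keys f \<subseteq> carrier (Mc c) \<times> carrier (Fp p)"
    using assms by simp
  show "0 - vec_tensor c (\<lambda>k. coord k 0) \<in> \<K>"
    by (simp add: coord_def vec_tensor_def kernel_0)
next
  fix f g
  assume "f - vec_tensor c (\<lambda>k. coord k f) \<in> \<K>" "g - vec_tensor c (\<lambda>k. coord k g) \<in> \<K>"
  from kernel_diff[OF this] show "f - g - vec_tensor c (\<lambda>k. coord k (f - g)) \<in> \<K>"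
    by (simp add: coord_def frag_eval_diff vec_tensor_diff algebra_simps)
next
  fix q assume "q \<in> carrier (Mc c) \<times> carrier (Fp p)"
  then show "frag_of q - vec_tensor c (\<lambda>k. coord k (frag_of q)) \<in> \<K>"
    using kernel_frag_of by (auto simp: coord_def)
qed

text \<open>If \<open>p\<close> divides every coordinate, each term of the normal form agrees modulo
  the kernel with x_k \<otimes> 0, itself in the kernel. Thus the coordinates modulo
  \<open>p\<close> are a complete invariant of classes.\<close>

lemma kernel_iff_coord:
  assumes "f \<in> carrier G"
  shows "f \<in> \<K> \<longleftrightarrow> (\<forall>k\<le>c. [coord k f = 0] (mod int p))"
proof
  assume "\<forall>k\<le>c. [coord k f = 0] (mod int p)"
  then have 0: "coord k f mod int p = 0" if "k \<le> c" for k
    using that by (simp add: cong_def)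
  have "frag_cmul (coord k f) (frag_of (basis_vec c k, 1)) \<in> \<K>" if "k \<le> c" for k
  proof -
    have "- frag_of (basis_vec c k, 0) \<in> \<K>"
      using kernel_add_right[OF basis_vec_carrier, of 0 0 k] m_gt_one
      by (simp add: carrier_Fp add_Fp)
    moreover have "frag_of (basis_vec c k, 0) - frag_cmul (coord k f) (frag_of (basis_vec c k, 1)) \<in> \<K>"
      using kernel_mod[OF basis_vec_carrier, of k "coord k f"] by (simp add: 0[OF that])
    ultimately have "- frag_cmul (coord k f) (frag_of (basis_vec c k, 1)) \<in> \<K>"
      using kernel_add by fastforce
    then show ?thesis
      using kernel_minus by fastforce
  qed
  then have "vec_tensor c (\<lambda>k. coord k f) \<in> \<K>"
    unfolding vec_tensor_def by (intro kernel_sum) simp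
  then show "f \<in> \<K>"
    using kernel_add[OF kernel_normal_form[OF assms]] by fastforce
qed (use coord_kernel in blast)

lemma class_eq_iff_coord:
  assumes "f \<in> carrier G" "g \<in> carrier G"
  shows "cls f = cls g \<longleftrightarrow> (\<forall>k\<le>c. [coord k f = coord k g] (mod int p))"
proof -
  have "f - g \<in> carrier G"
    using assms keys_diff[of f g] by auto
  then show ?thesis
    by (simp add: class_eq_iff kernel_iff_coord)
       (simp add: coord_def frag_eval_diff cong_diff_iff_cong_0)
qed

lemma coord_class:
  assumes "f' \<in> cls f" "k \<le> c"
  shows "[coord k f' = coord k f] (mod int p)"
  using coord_kernel[of "f' - f" k] assms
  by (simp add: mem_class_iff coord_def frag_eval_diff cong_diff_iff_cong_0)

lemma vec_tensor_carrier: "vec_tensor c v \<in> carrier G"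
  unfolding vec_tensor_def
  by (rule sum_closed_free_Abelian_group)
     (use basis_vec_carrier one_carrier in \<open>auto dest: subsetD[OF keys_cmul]\<close>)

definition \<theta> :: "(nat \<Rightarrow> int) \<Rightarrow> ((nat \<Rightarrow> int) \<times> int \<Rightarrow>\<^sub>0 int) set" where
  "\<theta> v = cls (vec_tensor c v)"

text \<open>The working tool below: a class is identified by computing the coordinates of one
  representative modulo \<open>p\<close>.\<close>

lemma class_eq_\<theta>:
  assumes "f \<in> carrier G" "\<And>k. k \<le> c \<Longrightarrow> [coord k f = v k] (mod int p)"
  shows "cls f = \<theta> v"
  unfolding \<theta>_def using assms
  by (simp add: class_eq_iff_coord vec_tensor_carrier coord_vec_tensor del: carrier_free_Abelian_group_iff)

lemma bij_\<theta>: "bij_betw \<theta> (carrier (Mp c p)) (carrier (base_change (Mc c) (Fp p)))"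
proof (rule bij_betw_imageI)
  show "inj_on \<theta> (carrier (Mp c p))"
  proof (rule inj_onI)
    fix v w assume vw: "v \<in> carrier (Mp c p)" "w \<in> carrier (Mp c p)" and "\<theta> v = \<theta> w"
    then have eq: "v k mod int p = w k mod int p" if "k \<le> c" for k
      using that by (simp add: \<theta>_def class_eq_iff_coord vec_tensor_carrier coord_vec_tensor cong_def
          del: carrier_free_Abelian_group_iff)
    have "v k = w k" if "k \<in> {..c}" for k
    proof -
      have "v k \<in> {0..<int p}" "w k \<in> {0..<int p}"
        using vw that by (auto simp: carrier_Mp)
      then show ?thesis
        using eq[of k] that by simp
    qed
    then show "v = w"
      using vw by (auto simp: carrier_Mp intro: PiE_ext)
  qed
  show "\<theta> ` carrier (Mp c p) = carrier (base_change (Mc c) (Fp p))"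
  proof (intro equalityI subsetI)
    fix X assume "X \<in> carrier (base_change (Mc c) (Fp p))"
    then obtain f where f: "f \<in> carrier G" "X = cls f"
      by (auto simp: base_change_def carrier_tensor_group)
    let ?v = "\<lambda>k\<in>{..c}. coord k f mod int p"
    have "X = \<theta> ?v"
      unfolding f(2) by (rule class_eq_\<theta>[OF f(1)]) simp
    moreover have "?v \<in> carrier (Mp c p)"
      using mod_in_range by (simp add: carrier_Mp)
    ultimately show "X \<in> \<theta> ` carrier (Mp c p)"
      by blast
  next
    fix X assume "X \<in> \<theta> ` carrier (Mp c p)"
    then show "X \<in> carrier (base_change (Mc c) (Fp p))"
      using vec_tensor_carrier by (auto simp: base_change_def carrier_tensor_group \<theta>_def
          simp del: carrier_free_Abelian_group_iff)
  qed
qed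

text \<open>Collapses the unions over representatives in \<open>base_change\<close>; the coset is
  nonempty because it contains \<open>f\<close>.\<close>

lemma UN_class_eq:
  assumes "\<And>f'. f' \<in> cls f \<Longrightarrow> F f' = Y"
  shows "(\<Union>f'\<in>cls f. F f') = Y"
proof -
  have "f \<in> cls f"
    by (simp add: mem_class_iff kernel_0)
  then show ?thesis
    using assms by blast
qed

lemma mem_\<theta>:
  assumes "f \<in> \<theta> v"
  shows "f \<in> carrier G" and "k \<le> c \<Longrightarrow> [coord k f = v k] (mod int p)"
  using class_subset[OF vec_tensor_carrier, of f v] coord_class[of f "vec_tensor c v" k] assms
  by (simp_all add: \<theta>_def coord_vec_tensor)

lemma smult_\<theta>:
  assumes r: "r \<in> carrier (Fp p)"
  shows "r \<odot>\<^bsub>base_change (Mc c) (Fp p)\<^esub> \<theta> v = \<theta> (r \<odot>\<^bsub>Mp c p\<^esub> v)"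
proof -
  let ?F = "\<lambda>f. frag_extend (\<lambda>(a, s). frag_of (a, r \<otimes>\<^bsub>Fp p\<^esub> s)) f"
  have "cls (?F f) = \<theta> (r \<odot>\<^bsub>Mp c p\<^esub> v)" if f: "f \<in> \<theta> v" for f
  proof (rule class_eq_\<theta>)
    show "?F f \<in> carrier G"
      using mod_in_range
      by (intro frag_extend_carrier[OF mem_\<theta>(1)[OF f]]) (simp add: carrier_Fp mult_Fp)
    fix k assume k: "k \<le> c"
    have "coord k (?F f) = frag_eval (\<lambda>(a, s). a k * (r * s mod int p)) f"
      by (simp add: coord_def frag_eval_extend case_prod_unfold mult_Fp)
    also have "[\<dots> = frag_eval (\<lambda>q. r * (\<lambda>(a, s). a k * s) q) f] (mod int p)"
    proof (rule frag_eval_cong)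
      fix q :: "(nat \<Rightarrow> int) \<times> int"
      obtain a s where q: "q = (a, s)" by fastforce
      have "[a k * (r * s mod int p) = a k * (r * s)] (mod int p)"
        by (intro cong_mult cong_refl) simp
      then show "[(\<lambda>(a, s). a k * (r * s mod int p)) q = r * (\<lambda>(a, s). a k * s) q] (mod int p)"
        by (simp add: q mult.left_commute)
    qed
    also have "frag_eval (\<lambda>q. r * (\<lambda>(a, s). a k * s) q) f = r * coord k f"
      by (simp add: frag_eval_mult_left coord_def)
    also have "[\<dots> = r * v k] (mod int p)"
      by (intro cong_mult cong_refl mem_\<theta>(2) f k)
    finally show "[coord k (?F f) = (r \<odot>\<^bsub>Mp c p\<^esub> v) k] (mod int p)"
      using k by (simp add: smult_Mp cong_def)
  qed
  then have "(\<Union>f\<in>\<theta> v. cls (?F f)) = \<theta> (r \<odot>\<^bsub>Mp c p\<^esub> v)"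
    unfolding \<theta>_def by (rule UN_class_eq)
  then show ?thesis
    by (simp add: base_change_def)
qed

text \<open>Coordinate \<open>k\<close> of the bracket of two formal sums is, modulo
  \<open>p\<close>, a bilinear expression in their coordinates 0 and \<open>k - 1\<close>. Hence it
  depends only on the classes, and the union is a single coset.\<close>

lemma bracket_\<theta>:
  "bracket (base_change (Mc c) (Fp p)) (\<theta> v) (\<theta> w) = \<theta> (bracket (Mp c p) v w)"
proof -
  let ?F = "\<lambda>f g. frag_extend (\<lambda>(a, r).
      frag_extend (\<lambda>(b, s). frag_of (bracket (Mc c) a b, r \<otimes>\<^bsub>Fp p\<^esub> s)) g) f"
  have "cls (?F f g) = \<theta> (bracket (Mp c p) v w)" if f: "f \<in> \<theta> v" and g: "g \<in> \<theta> w" for f g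
  proof (rule class_eq_\<theta>)
    show "?F f g \<in> carrier G"
      using mod_in_range
      by (intro frag_extend_carrier[OF mem_\<theta>(1)[OF f]], unfold prod.case,
          intro frag_extend_carrier[OF mem_\<theta>(1)[OF g]], unfold prod.case)
         (simp add: carrier_Fp mult_Fp carrier_Mc Defs.bracket_Mc)
    fix k assume k: "k \<le> c"
    let ?b = "\<lambda>a b. if 2 \<le> k then a 0 * b (k - 1) - b 0 * a (k - 1) else (0::int)"
    \<comment> \<open>Writing the condition \<open>2 \<le> k\<close> as a factor lets the evaluation
      rules for products apply uniformly in \<open>k\<close>.\<close>
    let ?d = "if 2 \<le> k then 1 else (0::int)"
    have "coord k (?F f g) =
        frag_eval (\<lambda>(a, r). frag_eval (\<lambda>(b, s). ?b a b * (r * s mod int p)) g) f"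
      using k by (simp add: coord_def frag_eval_extend case_prod_unfold mult_Fp Defs.bracket_Mc)
    also have "[\<dots> = frag_eval (\<lambda>q. ?d * ((\<lambda>(a, r). a 0 * r) q * coord (k - 1) g
        - (\<lambda>(a, r). a (k - 1) * r) q * coord 0 g)) f] (mod int p)"
    proof (rule frag_eval_cong)
      fix q :: "(nat \<Rightarrow> int) \<times> int"
      obtain a r where q: "q = (a, r)" by fastforce
      \<comment> \<open>The inner sum over \<open>g\<close> is evaluated first, with one symbol
        \<open>(a, r)\<close> of \<open>f\<close> held fixed.\<close>
      have "[frag_eval (\<lambda>(b, s). ?b a b * (r * s mod int p)) g =
          frag_eval (\<lambda>q. ?d * (a 0 * r * (\<lambda>(b, s). b (k - 1) * s) q
            - a (k - 1) * r * (\<lambda>(b, s). b 0 * s) q)) g] (mod int p)"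
      proof (rule frag_eval_cong)
        fix q' :: "(nat \<Rightarrow> int) \<times> int"
        obtain b s where q': "q' = (b, s)" by fastforce
        have "[?b a b * (r * s mod int p) = ?b a b * (r * s)] (mod int p)"
          by (intro cong_mult cong_refl) simp
        then show "[(\<lambda>(b, s). ?b a b * (r * s mod int p)) q' =
            ?d * (a 0 * r * (\<lambda>(b, s). b (k - 1) * s) q'
              - a (k - 1) * r * (\<lambda>(b, s). b 0 * s) q')] (mod int p)"
          by (cases "2 \<le> k") (simp_all add: q' algebra_simps)
      qed
      then show "[(\<lambda>(a, r). frag_eval (\<lambda>(b, s). ?b a b * (r * s mod int p)) g) q =
          ?d * ((\<lambda>(a, r). a 0 * r) q * coord (k - 1) g
            - (\<lambda>(a, r). a (k - 1) * r) q * coord 0 g)] (mod int p)"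
        by (simp add: q frag_eval_mult_left frag_eval_diff_left coord_def)
    qed
    also have "frag_eval (\<lambda>q. ?d * ((\<lambda>(a, r). a 0 * r) q * coord (k - 1) g
        - (\<lambda>(a, r). a (k - 1) * r) q * coord 0 g)) f =
        ?d * (coord 0 f * coord (k - 1) g - coord (k - 1) f * coord 0 g)"
      by (simp only: frag_eval_mult_left frag_eval_diff_left frag_eval_mult_right coord_def)
    also have "[\<dots> = ?d * (v 0 * w (k - 1) - v (k - 1) * w 0)] (mod int p)"
      by (intro cong_mult cong_diff cong_refl mem_\<theta>(2) f g) (use k in auto)
    finally show "[coord k (?F f g) = bracket (Mp c p) v w k] (mod int p)"
      using k by (auto simp: bracket_Mp cong_def mult.commute)
  qed
  then have "(\<Union>g\<in>\<theta> w. cls (?F f g)) = \<theta> (bracket (Mp c p) v w)" if "f \<in> \<theta> v" for f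
    unfolding \<theta>_def[of w] using that by (intro UN_class_eq) (simp add: \<theta>_def)
  then have "(\<Union>f\<in>\<theta> v. \<Union>g\<in>\<theta> w. cls (?F f g)) = \<theta> (bracket (Mp c p) v w)"
    unfolding \<theta>_def[of v] by (rule UN_class_eq)
  then show ?thesis
    by (simp add: base_change_def)
qed

lemma add_\<theta>: "\<theta> v \<oplus>\<^bsub>base_change (Mc c) (Fp p)\<^esub> \<theta> w = \<theta> (v \<oplus>\<^bsub>Mp c p\<^esub> w)"
proof -
  have "cls (vec_tensor c v + vec_tensor c w) = \<theta> (v \<oplus>\<^bsub>Mp c p\<^esub> w)"
  proof (rule class_eq_\<theta>)
    show "vec_tensor c v + vec_tensor c w \<in> carrier G"
      using vec_tensor_carrier[of v] vec_tensor_carrier[of w] by (auto dest!: subsetD[OF keys_add])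
  qed (use coord_vec_tensor in \<open>simp add: coord_def frag_eval_add add_Mp\<close>)
  then show ?thesis
    using mult_tensor_group[OF vec_tensor_carrier vec_tensor_carrier, of v w]
    by (simp add: base_change_def \<theta>_def)
qed

lemma zero_\<theta>: "\<zero>\<^bsub>base_change (Mc c) (Fp p)\<^esub> = \<theta> \<zero>\<^bsub>Mp c p\<^esub>"
proof -
  have "cls 0 = \<theta> \<zero>\<^bsub>Mp c p\<^esub>"
    by (rule class_eq_\<theta>) (simp_all add: coord_def zero_Mp)
  then show ?thesis
    by (simp add: base_change_def one_tensor_group)
qed

text \<open>From here the dimension and the ideal counts of the tensor product are those of
  \<open>Mp c p\<close>.\<close>

sublocale lie_transport "Fp p" "Mp c p" "base_change (Mc c) (Fp p)" \<theta>
proof (rule lie_transport.intro)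
  show "bracket (Mp c p) v w \<in> carrier (Mp c p)" for v w
    using mod_in_range m_gt_one by (simp add: bracket_Mp carrier_Mp)
qed (simp_all add: vectorspace_Mp bij_\<theta> zero_\<theta> add_\<theta> smult_\<theta> bracket_\<theta>)

end

section \<open>Assembling the zeta function\<close>

theorem theorem3p1:
  fixes c p :: nat and s t :: complex
  assumes "c \<ge> 2" and "prime p" and "t = of_nat p powr (- s)"
  shows "ideal_zeta p (base_change (Mc c) (Fp p)) s
           = 1 + (1 + of_nat p) * t + (\<Sum>k = 2..c + 1. t ^ k) \<and>
         1 + (1 + of_nat p) * t + (\<Sum>k = 2..c + 1. t ^ k)
           = subspace_zeta p 2 s + (\<Sum>k = 3..c + 1. t ^ k)"
proof -
  interpret residues_prime p "Fp p"
    by (simp_all add: residues_prime_def assms)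
  interpret T: mc_tensor "Fp p" p c
    by (simp_all add: mc_tensor_def residues_prime_def assms)
  \<comment> \<open>Index 1 is isolated because it carries the exceptional count
    \<open>p + 1\<close>; index 2 is split off to match the top term of the zeta function of the
    plane.\<close>
  have split: "{0..c + 1} = insert 0 (insert 1 {2..c + 1})" "{2..c + 1} = insert 2 {3..c + 1}"
    using assms(1) by auto
  have "ideal_zeta p (base_change (Mc c) (Fp p)) s =
      (\<Sum>i = 0..c + 1. of_nat (if i = 1 then p + 1 else 1) * t ^ i)"
    unfolding ideal_zeta_def assms(3)
    using T.dim_transport T.num_ideals_transport num_ideals_Mp assms(1) dim_Mp
      finite_carrier_Fp finite_carrier_Mp
    by (intro sum.cong) auto
  also have "\<dots> = 1 + (1 + of_nat p) * t + (\<Sum>k = 2..c + 1. t ^ k)"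
    unfolding split(1) by (simp add: add.assoc add.commute)
  finally have zeta: "ideal_zeta p (base_change (Mc c) (Fp p)) s =
      1 + (1 + of_nat p) * t + (\<Sum>k = 2..c + 1. t ^ k)" .
  have "{0..2::nat} = {0, 1, 2}"
    by auto
  then have "subspace_zeta p 2 s = 1 + (1 + of_nat p) * t + t ^ 2"
    unfolding subspace_zeta_def assms(3) by (simp add: gaussian_binomial_2 add.commute)
  moreover have "(\<Sum>k = 2..c + 1. t ^ k) = t ^ 2 + (\<Sum>k = 3..c + 1. t ^ k)"
    unfolding split(2) by simp
  ultimately show ?thesis
    using zeta by simp
qed

end
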